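(* Let $\mathbb{K}$ be a local field, $E$ and $F$ be topological $\mathbb{K}$-vector spaces, $f\colon U\to F$ a map on an open subset $U$ of $E$, and $k\in\mathbb{N}_0$. If $E$ is metrizable and $F$ is Mackey complete and locally convex, then we have: (a) If $f$ is $C^k_{\mathbb{K}}$, then $f$ is weakly $C^k$, i.e. $\lambda\circ f$ is $C^k_{\mathbb{K}}$ for each continuous linear functional $\lambda\colon F\to\mathbb{K}$. (b) If $f$ is weakly $C^{k+1}$, then $f$ is $C^k_{\mathbb{K}}$. In particular, $f$ is smooth if and only if $f$ is weakly smooth (i.e. $\lambda\circ f$ is smooth for each continuous linear functional $\lambda$ on $F$).
   Context: All topological spaces, fields and topological vector spaces are Hausdorff. A local field is a totally disconnected, locally compact, non-discrete topological field; its topology is given by an ultrametric absolute value with valuation ring $\mathbb{O}=\{x:|x|\le1\}$. $F$ is locally convex if every zero-neighbourhood contains an open $\mathbb{O}$-submodule. $F$ is Mackey complete if every Mackey–Cauchy sequence converges, where $(x_n)_{n\in\mathbb{N}}$ is Mackey–Cauchy if there are a bounded set $B\subseteq F$ and $\mu_{n,m}\in\mathbb{K}$ with $x_n-x_m\in\mu_{n,m}B$ for all $n,m$ and $\mu_{n,m}\to0$ as both $n,m\to\infty$. Differential calculus over $\mathbb{K}$: For $U$ open in a topological $\mathbb{K}$-vector space $E$, put $U^{[0]}:=U$, $U^{[1]}:=\{(x,y,t)\in U\times E\times\mathbb{K}: x+ty\in U\}$, $U^{[j+1]}:=(U^{[j]})^{[1]}$. A map $f\colon U\to F$ is $C^0_{\mathbb{K}}$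 if it is continuous ($f^{[0]}:=f$); $C^1_{\mathbb{K}}$ if it is continuous and there is a (unique) continuous $f^{[1]}\colon U^{[1]}\to F$ with $f^{[1]}(x,y,t)=\frac1t(f(x+ty)-f(x))$ whenever $t\ne0$; $C^k_{\mathbb{K}}$ ($k\ge2$) if it is $C^{k-1}_{\mathbb{K}}$ and $f^{[k-1]}$ is $C^1_{\mathbb{K}}$, with $f^{[k]}:=(f^{[k-1]})^{[1]}$; smooth if $C^k_{\mathbb{K}}$ for all $k\in\mathbb{N}_0$. *)

theory Defs
  imports "HOL-Analysis.Analysis"
begin

section \<open>Local fields and topological vector spaces\<close>

class local_field = field + topological_ab_group_add + topological_semigroup_mult + t2_space +
  assumes tendsto_inverse_nhds: "a \<noteq> 0 \<Longrightarrow> filterlim inverse (nhds (inverse a)) (nhds a)"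
    and totally_disconnected: "connected S \<Longrightarrow> x \<in> S \<Longrightarrow> y \<in> S \<Longrightarrow> x = y"
    and locally_compact: "\<exists>V C. open V \<and> compact C \<and> x \<in> V \<and> V \<subseteq> C"
    and non_discrete: "\<exists>S. \<not> open S"

text \<open>
  The last conjunct says that \<open>v\<close> induces the given topology. Such a \<open>v\<close> exists on every local
  field and is unique up to powers, so the valuation ring is independent of it.
\<close>

definition ultrametric_absolute_value :: "('k::local_field \<Rightarrow> real) \<Rightarrow> bool" where
  "ultrametric_absolute_value v \<longleftrightarrow>
     (\<forall>x. 0 \<le> v x) \<and> (\<forall>x. v x = 0 \<longleftrightarrow> x = 0) \<and>
     (\<forall>x y. v (x * y) = v x * v y) \<and>
     (\<forall>x y. v (x + y) \<le> max (v x) (v y)) \<and>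
     (\<forall>S. open S \<longleftrightarrow> (\<forall>x\<in>S. \<exists>e>0. \<forall>y. v (y - x) < e \<longrightarrow> y \<in> S))"

definition valuation_ring :: "('k::local_field \<Rightarrow> real) \<Rightarrow> 'k set" where
  "valuation_ring v = {x. v x \<le> 1}"

text \<open>Addition is continuous, and the topology Hausdorff, by the sort of the vector type.\<close>

definition topological_vector_space ::
  "('k::local_field \<Rightarrow> 'e \<Rightarrow> 'e::{topological_ab_group_add,t2_space}) \<Rightarrow> bool" where
  "topological_vector_space smul \<longleftrightarrow>
     vector_space smul \<and> continuous_on UNIV (\<lambda>(c, x). smul c x)"

definition locally_convex ::
  "('k::local_field \<Rightarrow> real) \<Rightarrow> ('k \<Rightarrow> 'e \<Rightarrow> 'e::{topological_ab_group_add,t2_space}) \<Rightarrow> bool" where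
  "locally_convex v smul \<longleftrightarrow>
     (\<forall>W. open W \<and> 0 \<in> W \<longrightarrow>
       (\<exists>M. open M \<and> M \<subseteq> W \<and> 0 \<in> M \<and> (\<forall>x\<in>M. \<forall>y\<in>M. x + y \<in> M) \<and>
            (\<forall>c\<in>valuation_ring v. \<forall>x\<in>M. smul c x \<in> M)))"

definition bounded_set ::
  "('k::local_field \<Rightarrow> 'e \<Rightarrow> 'e::{topological_ab_group_add,t2_space}) \<Rightarrow> 'e set \<Rightarrow> bool" where
  "bounded_set smul B \<longleftrightarrow> (\<forall>W. open W \<and> 0 \<in> W \<longrightarrow> (\<exists>c. c \<noteq> 0 \<and> B \<subseteq> smul c ` W))"

definition mackey_Cauchy ::
  "('k::local_field \<Rightarrow> 'e \<Rightarrow> 'e::{topological_ab_group_add,t2_space}) \<Rightarrow> (nat \<Rightarrow> 'e) \<Rightarrow> bool" where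
  "mackey_Cauchy smul x \<longleftrightarrow>
     (\<exists>B \<mu>. bounded_set smul B \<and> (\<forall>n m. x n - x m \<in> smul (\<mu> n m) ` B) \<and>
        ((\<lambda>(n, m). \<mu> n m) \<longlongrightarrow> 0) (sequentially \<times>\<^sub>F sequentially))"

definition mackey_complete ::
  "('k::local_field \<Rightarrow> 'e \<Rightarrow> 'e::{topological_ab_group_add,t2_space}) \<Rightarrow> bool" where
  "mackey_complete smul \<longleftrightarrow> (\<forall>x. mackey_Cauchy smul x \<longrightarrow> convergent x)"

section \<open>The iterated domains\<close>

text \<open>
  The spaces \<open>E\<^sub>0 = E\<close>, \<open>E\<^sub>j\<^sub>+\<^sub>1 = E\<^sub>j \<times> E\<^sub>j \<times> K\<close> have different types, so they are all embedded in one
  datatype: \<open>Base\<close> injects \<open>E\<^sub>0\<close>, and \<open>Ext x y t\<close> is the triple \<open>(x, y, t)\<close>. The set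
  \<open>level_space j\<close> is the copy of \<open>E\<^sub>j\<close>, with the product topology \<open>level_topology j\<close>;
  the vector operations are only meaningful within one level.
\<close>

datatype ('k, 'e) point =
    Base (the_base: 'e)
  | Ext (ext_pt: "('k, 'e) point") (ext_dir: "('k, 'e) point") (ext_par: 'k)

fun point_add :: "('k::plus, 'e::plus) point \<Rightarrow> ('k, 'e) point \<Rightarrow> ('k, 'e) point" where
  "point_add (Base x) (Base x') = Base (x + x')"
| "point_add (Ext x y t) (Ext x' y' t') = Ext (point_add x x') (point_add y y') (t + t')"
| "point_add _ _ = undefined"

primrec point_scale ::
  "('k::times \<Rightarrow> 'e \<Rightarrow> 'e) \<Rightarrow> 'k \<Rightarrow> ('k, 'e) point \<Rightarrow> ('k, 'e) point" where
  "point_scale smul c (Base x) = Base (smul c x)"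
| "point_scale smul c (Ext x y t) = Ext (point_scale smul c x) (point_scale smul c y) (c * t)"

primrec level_space :: "nat \<Rightarrow> ('k, 'e) point set" where
  "level_space 0 = range Base"
| "level_space (Suc j) = {Ext x y t |x y t. x \<in> level_space j \<and> y \<in> level_space j}"

primrec level_topology :: "nat \<Rightarrow> ('k::topological_space, 'e::topological_space) point topology" where
  "level_topology 0 = pullback_topology (level_space 0) the_base euclidean"
| "level_topology (Suc j) =
     pullback_topology (level_space (Suc j)) (\<lambda>p. (ext_pt p, ext_dir p, ext_par p))
       (prod_topology (level_topology j) (prod_topology (level_topology j) euclidean))"

text \<open>The copy of \<open>U\<^bsup>[j]\<^esup>\<close>.\<close>

primrec iter_domain ::
  "('k::{plus,times} \<Rightarrow> 'e::plus \<Rightarrow> 'e) \<Rightarrow> 'e set \<Rightarrow> nat \<Rightarrow> ('k, 'e) point set" where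
  "iter_domain smul U 0 = Base ` U"
| "iter_domain smul U (Suc j) =
     {Ext x y t |x y t. x \<in> iter_domain smul U j \<and> y \<in> level_space j \<and>
        point_add x (point_scale smul t y) \<in> iter_domain smul U j}"

section \<open>Differentiability\<close>

definition continuous_level ::
  "('k::local_field \<Rightarrow> 'e \<Rightarrow> 'e::{topological_ab_group_add,t2_space}) \<Rightarrow> 'e set \<Rightarrow> nat \<Rightarrow>
   (('k, 'e) point \<Rightarrow> 'f::topological_space) \<Rightarrow> bool" where
  "continuous_level scaleE U j f \<longleftrightarrow>
     continuous_map (subtopology (level_topology j) (iter_domain scaleE U j)) euclidean f"

text \<open>\<open>g\<close> is \<open>f\<^bsup>[1]\<^esup>\<close> for the map \<open>f\<close> on \<open>U\<^bsup>[j]\<^esup>\<close>.\<close>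

definition is_difference_quotient ::
  "('k::local_field \<Rightarrow> 'e \<Rightarrow> 'e::{topological_ab_group_add,t2_space}) \<Rightarrow>
   ('k \<Rightarrow> 'f \<Rightarrow> 'f::{topological_ab_group_add,t2_space}) \<Rightarrow> 'e set \<Rightarrow> nat \<Rightarrow>
   (('k, 'e) point \<Rightarrow> 'f) \<Rightarrow> (('k, 'e) point \<Rightarrow> 'f) \<Rightarrow> bool" where
  "is_difference_quotient scaleE scaleF U j f g \<longleftrightarrow>
     continuous_level scaleE U (Suc j) g \<and>
     (\<forall>x y t. Ext x y t \<in> iter_domain scaleE U (Suc j) \<and> t \<noteq> 0 \<longrightarrow>
        g (Ext x y t) = scaleF (1 / t) (f (point_add x (point_scale scaleE t y)) - f x))"

definition C1_level ::
  "('k::local_field \<Rightarrow> 'e \<Rightarrow> 'e::{topological_ab_group_add,t2_space}) \<Rightarrow>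
   ('k \<Rightarrow> 'f \<Rightarrow> 'f::{topological_ab_group_add,t2_space}) \<Rightarrow> 'e set \<Rightarrow> nat \<Rightarrow>
   (('k, 'e) point \<Rightarrow> 'f) \<Rightarrow> bool" where
  "C1_level scaleE scaleF U j f \<longleftrightarrow>
     continuous_level scaleE U j f \<and> (\<exists>g. is_difference_quotient scaleE scaleF U j f g)"

text \<open>
  The map \<open>f\<^bsup>[j]\<^esup>\<close>. The choice only concerns values off \<open>U\<^bsup>[j]\<^esup>\<close>, which are irrelevant: on
  \<open>U\<^bsup>[j]\<^esup>\<close> the continuous extension is unique whenever it exists.
\<close>

primrec iter_quotient ::
  "('k::local_field \<Rightarrow> 'e \<Rightarrow> 'e::{topological_ab_group_add,t2_space}) \<Rightarrow>
   ('k \<Rightarrow> 'f \<Rightarrow> 'f::{topological_ab_group_add,t2_space}) \<Rightarrow> 'e set \<Rightarrow> ('e \<Rightarrow> 'f) \<Rightarrow> nat \<Rightarrow>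
   (('k, 'e) point \<Rightarrow> 'f)" where
  "iter_quotient scaleE scaleF U f 0 = (\<lambda>p. f (the_base p))"
| "iter_quotient scaleE scaleF U f (Suc j) =
     (SOME g. is_difference_quotient scaleE scaleF U j (iter_quotient scaleE scaleF U f j) g)"

primrec Ck ::
  "('k::local_field \<Rightarrow> 'e \<Rightarrow> 'e::{topological_ab_group_add,t2_space}) \<Rightarrow>
   ('k \<Rightarrow> 'f \<Rightarrow> 'f::{topological_ab_group_add,t2_space}) \<Rightarrow> nat \<Rightarrow> 'e set \<Rightarrow> ('e \<Rightarrow> 'f) \<Rightarrow> bool" where
  "Ck scaleE scaleF 0 U f \<longleftrightarrow> continuous_on U f"
| "Ck scaleE scaleF (Suc k) U f \<longleftrightarrow>
     Ck scaleE scaleF k U f \<and> C1_level scaleE scaleF U k (iter_quotient scaleE scaleF U f k)"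

definition smooth_map ::
  "('k::local_field \<Rightarrow> 'e \<Rightarrow> 'e::{topological_ab_group_add,t2_space}) \<Rightarrow>
   ('k \<Rightarrow> 'f \<Rightarrow> 'f::{topological_ab_group_add,t2_space}) \<Rightarrow> 'e set \<Rightarrow> ('e \<Rightarrow> 'f) \<Rightarrow> bool" where
  "smooth_map scaleE scaleF U f \<longleftrightarrow> (\<forall>k. Ck scaleE scaleF k U f)"

definition continuous_functional ::
  "('k::local_field \<Rightarrow> 'f \<Rightarrow> 'f::{topological_ab_group_add,t2_space}) \<Rightarrow> ('f \<Rightarrow> 'k) \<Rightarrow> bool" where
  "continuous_functional smul l \<longleftrightarrow> Vector_Spaces.linear smul (*) l \<and> continuous_on UNIV l"

definition weakly_Ck ::
  "('k::local_field \<Rightarrow> 'e \<Rightarrow> 'e::{topological_ab_group_add,t2_space}) \<Rightarrow>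
   ('k \<Rightarrow> 'f \<Rightarrow> 'f::{topological_ab_group_add,t2_space}) \<Rightarrow> nat \<Rightarrow> 'e set \<Rightarrow> ('e \<Rightarrow> 'f) \<Rightarrow> bool" where
  "weakly_Ck scaleE scaleF k U f \<longleftrightarrow>
     (\<forall>l. continuous_functional scaleF l \<longrightarrow> Ck scaleE (*) k U (l \<circ> f))"

definition weakly_smooth ::
  "('k::local_field \<Rightarrow> 'e \<Rightarrow> 'e::{topological_ab_group_add,t2_space}) \<Rightarrow>
   ('k \<Rightarrow> 'f \<Rightarrow> 'f::{topological_ab_group_add,t2_space}) \<Rightarrow> 'e set \<Rightarrow> ('e \<Rightarrow> 'f) \<Rightarrow> bool" where
  "weakly_smooth scaleE scaleF U f \<longleftrightarrow>
     (\<forall>l. continuous_functional scaleF l \<longrightarrow> smooth_map scaleE (*) U (l \<circ> f))"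

end

(*
The heart is a one-step principle: if l o g is C^2 for every continuous functional l, then g is C^1.
Continuity comes from metrizability: if p_n -> x, one can write p_n = x + t_n y_n with t_n -> 0 and
y_n -> 0, and the vectors (g p_n - g x) / t_n are weakly bounded because the difference quotients of
l o g converge. Weakly bounded sets of a locally convex space over a local field are bounded (Mackey's
theorem, by Hahn-Banach and a gliding hump), hence g p_n -> g x. The second derivatives of the l o g
similarly make the difference quotients of g at t = pi^n a Mackey-Cauchy sequence; its limit extends
the quotient of g to t = 0, and this extension is weakly C^1, hence continuous. Applying the principle
to the iterated quotients of f gives (b) by induction.
*)

theory Submission
  imports Defs
begin

section \<open>Ultrametric estimates, balls and compactness in a local field\<close>

section \<open>Local fields\<close>

text \<open>Local compactness enters through spherical completeness. In the Hahn-Banach step the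
  admissible values at a new vector form pairwise meeting balls; in the gliding hump the values of
  the limit functional are chosen in the same way.

  \<open>F\<close> carries no metric, so Mackey's theorem is proved against one open submodule
  \<open>M\<close> at a time. All functionals of the construction lie in the polar of
  \<open>M\<close>; it contains the limit as well, and its members are automatically continuous.

  Small scalars are always powers of one fixed \<open>\<pi>\<close>, and rescaling by them replaces
  division by a norm.

  Only one order is lost in (b), although every use of the one-step principle costs one. The
  principle yields the next quotient with values in \<open>F\<close>, and uniqueness of continuous
  extensions identifies its scalar compositions with the iterated quotients of
  \<open>l \<circ> f\<close>, whose orders are known in advance. Every stage thus draws its second
  derivatives from the original hypothesis.\<close>

locale ultrametric_field =
  fixes v :: "'k::local_field \<Rightarrow> real"
  assumes absolute_value: "ultrametric_absolute_value v"
begin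

lemma v_nonneg [simp]: "0 \<le> v x"
  and v_eq_0 [simp]: "v x = 0 \<longleftrightarrow> x = 0"
  and v_mult: "v (x * y) = v x * v y"
  and v_add_le: "v (x + y) \<le> max (v x) (v y)"
  using absolute_value unfolding ultrametric_absolute_value_def by simp_all

lemma open_iff: "open S \<longleftrightarrow> (\<forall>x\<in>S. \<exists>e>0. \<forall>y. v (y - x) < e \<longrightarrow> y \<in> S)"
  using absolute_value unfolding ultrametric_absolute_value_def by (elim conjE) (erule spec)

lemma v_0 [simp]: "v 0 = 0"
  by simp

lemma v_pos_iff [simp]: "0 < v x \<longleftrightarrow> x \<noteq> 0"
  using v_nonneg[of x] v_eq_0[of x] by linarith

lemma v_1 [simp]: "v 1 = 1"
  using v_mult[of 1 1] v_eq_0[of 1] by simp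

lemma v_minus [simp]: "v (- x) = v x"
proof -
  have "v (-1) * v (-1) = 1" using v_mult[of "-1" "-1"] by simp
  then have "v (-1) = 1" using v_nonneg[of "-1"] by (simp add: square_eq_1_iff)
  then show ?thesis using v_mult[of "-1" x] by simp
qed

lemma v_minus_commute: "v (x - y) = v (y - x)"
  using v_minus[of "x - y"] by simp

lemma v_diff_le: "v (x - y) \<le> max (v x) (v y)"
  using v_add_le[of x "- y"] by simp

lemma v_power: "v (x ^ n) = v x ^ n"
  by (induction n) (auto simp: v_mult)

lemma v_inverse: "v (inverse x) = inverse (v x)"
proof (cases "x = 0")
  case False
  then have "v (inverse x) * v x = 1" by (simp flip: v_mult)
  then show ?thesis by (metis inverse_unique mult.commute)
qed simp

lemma v_divide: "v (x / y) = v x / v y"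
  by (simp add: divide_inverse v_mult v_inverse)

lemma open_v_ball: "open {y. v (y - a) < e}"
  unfolding open_iff
proof clarsimp
  fix x assume x: "v (x - a) < e"
  have "v (y - a) < e" if "v (y - x) < e" for y
    using v_add_le[of "y - x" "x - a"] that x by simp
  moreover have "0 < e" using x v_nonneg[of "x - a"] by linarith
  ultimately show "\<exists>d>0. \<forall>y. v (y - x) < d \<longrightarrow> v (y - a) < e" by blast
qed

lemma closed_v_ball: "closed {y. v (y - a) \<le> r}"
  unfolding closed_def open_iff
proof
  fix x assume "x \<in> - {y. v (y - a) \<le> r}"
  then have x: "r < v (x - a)" by simp
  have r: "r < v (y - a)" if "v (y - x) < v (x - a)" for y
  proof (rule ccontr)
    assume "\<not> ?thesis"
    then have "v (y - a) < v (x - a)" using x by linarith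
    then show False
      using v_add_le[of "x - y" "y - a"] that v_minus_commute[of x y] by simp
  qed
  have "\<exists>d>0. \<forall>y. v (y - x) < d \<longrightarrow> r < v (y - a)"
  \<comment> \<open>For negative \<open>r\<close> the ball is empty and \<open>v (x - a)\<close> may
    be 0, so it cannot serve as a radius; any radius works.\<close>
  proof (cases "r < 0")
    case True
    then have "r < v (y - a)" for y using v_nonneg[of "y - a"] by linarith
    then show ?thesis using zero_less_one by blast
  next
    case False
    then have "0 < v (x - a)" using x by linarith
    then show ?thesis using r by blast
  qed
then show "\<exists>d>0. \<forall>y. v (y - x) < d \<longrightarrow> y \<in> - {y. v (y - a) \<le> r}"
    by (simp add: not_le)
qed

lemma tendsto_v_iff: "(x \<longlongrightarrow> l) F \<longleftrightarrow> (\<forall>e>0. \<forall>\<^sub>F n in F. v (x n - l) < e)"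
proof
  assume *: "(x \<longlongrightarrow> l) F"
  show "\<forall>e>0. \<forall>\<^sub>F n in F. v (x n - l) < e"
    using topological_tendstoD[OF * open_v_ball] by auto
next
  assume *: "\<forall>e>0. \<forall>\<^sub>F n in F. v (x n - l) < e"
  show "(x \<longlongrightarrow> l) F"
  proof (rule topological_tendstoI)
    fix S assume "open S" "l \<in> S"
    then obtain e where "e > 0" and e: "\<And>y. v (y - l) < e \<Longrightarrow> y \<in> S"
      unfolding open_iff by blast
    show "\<forall>\<^sub>F n in F. x n \<in> S"
      using *[rule_format, OF \<open>e > 0\<close>] by (rule eventually_mono) (rule e)
  qed
qed

lemma tendsto_v_zero_iff: "(x \<longlongrightarrow> 0) F \<longleftrightarrow> (\<forall>e>0. \<forall>\<^sub>F n in F. v (x n) < e)"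
  by (simp add: tendsto_v_iff)

lemma metrizable_field: "metrizable_space (euclidean :: 'k topology)"
proof -
  interpret M: Metric_space "UNIV :: 'k set" "\<lambda>x y. v (x - y)"
  proof
    fix x y z :: 'k
    have "v (x - z) \<le> max (v (x - y)) (v (y - z))"
      using v_add_le[of "x - y" "y - z"] by simp
    then show "v (x - z) \<le> v (x - y) + v (y - z)"
      using v_nonneg[of "x - y"] v_nonneg[of "y - z"] by linarith
  qed (auto simp: v_minus_commute)
  have "M.mtopology = euclidean"
    unfolding topology_eq M.openin_mtopology M.mball_def open_openin[symmetric] open_iff
    by (auto simp: subset_iff v_minus_commute)
  then show ?thesis
    unfolding metrizable_space_def using M.Metric_space_axioms by metis
qed

text \<open>Otherwise the open unit ball around 0 is {0}, and the topology is discrete.\<close>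

lemma exists_small: "\<exists>p. p \<noteq> 0 \<and> v p < 1"
proof (rule ccontr)
  assume "\<not> ?thesis"
  then have *: "\<And>p. v p < 1 \<Longrightarrow> p = 0" by auto
  have "open S" for S :: "'k set"
    unfolding open_iff using * by (metis eq_iff_diff_eq_0 zero_less_one)
  then show False using non_discrete by blast
qed

text \<open>Any scalar of absolute value strictly between 0 and 1 will do; it need not generate the
  maximal ideal.\<close>

definition \<pi> :: 'k where "\<pi> = (SOME p. p \<noteq> 0 \<and> v p < 1)"

lemma pi_nonzero [simp]: "\<pi> \<noteq> 0" and v_pi: "v \<pi> < 1"
  using someI_ex[OF exists_small] unfolding \<pi>_def by auto

lemma v_pi_power_tendsto: "(\<lambda>n. v (\<pi> ^ n)) \<longlonglongrightarrow> 0"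
  unfolding v_power using v_pi by (intro LIMSEQ_power_zero) simp

lemma ex_v_pi_power: "0 < e \<Longrightarrow> \<exists>n. v (\<pi> ^ n) < e"
  unfolding v_power using v_pi real_arch_pow_inv by blast

lemma pi_power_tendsto:
  assumes "filterlim a at_top F" shows "((\<lambda>n. \<pi> ^ a n) \<longlongrightarrow> 0) F"
  unfolding tendsto_v_zero_iff
  using order_tendstoD(2)[OF filterlim_compose[OF v_pi_power_tendsto assms]] by simp

lemma tendsto_quotient:
  fixes x y :: "'b \<Rightarrow> 'k"
  assumes "(x \<longlongrightarrow> a) F" "(y \<longlongrightarrow> b) F" "b \<noteq> 0"
  shows "((\<lambda>n. x n / y n) \<longlongrightarrow> a / b) F"
  unfolding divide_inverse
  by (intro tendsto_mult assms(1) filterlim_compose[OF tendsto_inverse_nhds[OF assms(3)] assms(2)])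

lemma convergent_imp_v_bounded:
  assumes "x \<longlonglongrightarrow> l"
  obtains C where "\<And>n. v (x n) \<le> C"
proof -
  obtain N where N: "\<And>n. n \<ge> N \<Longrightarrow> v (x n - l) < 1"
    using assms unfolding tendsto_v_iff eventually_sequentially by (meson zero_less_one)
  let ?C = "Max (insert (max 1 (v l)) ((\<lambda>n. v (x n)) ` {..<N}))"
  have "v (x n) \<le> ?C" for n
  proof (cases "n < N")
    case False
    then have "v (x n) \<le> max 1 (v l)"
      using v_add_le[of "x n - l" l] N[of n] by simp
    then show ?thesis by (simp add: Max_ge_iff)
  qed auto
  then show ?thesis using that by blast
qed

text \<open>Some compact set contains a small ball around 0; divided by a high power of
  \<open>\<pi>\<close> and translated, it covers the given ball, which is closed.\<close>

lemma compact_v_ball: "compact {y. v (y - a) \<le> r}"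
proof -
  obtain V C where V: "open V" "compact C" "(0::'k) \<in> V" "V \<subseteq> C"
    using locally_compact by blast
  then obtain e where "e > 0" and e: "\<And>y. v y < e \<Longrightarrow> y \<in> V"
    unfolding open_iff by fastforce
  have "0 < e / (\<bar>r\<bar> + 1)" using \<open>e > 0\<close> by auto
  then obtain n where n: "v (\<pi> ^ n) < e / (\<bar>r\<bar> + 1)" using ex_v_pi_power by blast
  let ?g = "\<lambda>c. a + c / \<pi> ^ n"
  have "continuous_on C ?g"
    unfolding continuous_on_def by (intro ballI tendsto_add tendsto_quotient tendsto_intros) auto
  then have "compact (?g ` C)" using V by (intro compact_continuous_image)
  moreover have "{y. v (y - a) \<le> r} \<subseteq> ?g ` C"
  proof
    fix y assume "y \<in> {y. v (y - a) \<le> r}"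
    then have "v ((y - a) * \<pi> ^ n) \<le> \<bar>r\<bar> * v (\<pi> ^ n)" unfolding v_mult by (auto intro!: mult_right_mono)
    also have "\<dots> \<le> (\<bar>r\<bar> + 1) * v (\<pi> ^ n)" by (intro mult_right_mono) auto
    also have "\<dots> < e" using n by (simp add: field_simps)
    finally have "(y - a) * \<pi> ^ n \<in> C" using e V by blast
    moreover have "y = ?g ((y - a) * \<pi> ^ n)" by simp
    ultimately show "y \<in> ?g ` C" by blast
  qed
  ultimately show ?thesis
    by (metis closed_v_ball compact_Int_closed inf.absorb_iff2)
qed

text \<open>The first hypothesis says that the balls meet pairwise, and of two meeting ultrametric
  balls the smaller lies in the larger. So the centre of a smallest ball is common to a finite
  subfamily, and compactness passes to arbitrary families.\<close>

lemma spherically_complete: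
  assumes meet: "\<And>i j. i \<in> I \<Longrightarrow> j \<in> I \<Longrightarrow> v (a i - a j) \<le> max (r i) (r j)"
    and pos: "\<And>i. i \<in> I \<Longrightarrow> 0 \<le> r i"
  shows "\<exists>y. \<forall>i\<in>I. v (y - a i) \<le> r i"
proof (cases "I = {}")
  case False
  then obtain i0 where i0: "i0 \<in> I" by blast
  let ?B = "\<lambda>i. {y. v (y - a i) \<le> r i}"
  have "?B i0 \<inter> (\<Inter>i\<in>I. ?B i) \<noteq> {}"
  proof (rule compact_imp_fip_image[OF compact_v_ball closed_v_ball])
    fix J assume J: "finite J" "J \<subseteq> I"
    let ?J = "insert i0 J"
    obtain m where m: "m \<in> ?J" "\<And>j. j \<in> ?J \<Longrightarrow> r m \<le> r j"
      using ex_min_if_finite[of "r ` ?J"] J by (force simp: not_less)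
    have "v (a m - a j) \<le> r j" if "j \<in> ?J" for j
      using meet[of m j] m that i0 J by (auto simp: max_def split: if_splits)
    then show "?B i0 \<inter> (\<Inter>i\<in>J. ?B i) \<noteq> {}" by blast
  qed
  then show ?thesis by blast
qed auto

end

section \<open>Submodules, their polars and extension of functionals\<close>

section \<open>The Hahn--Banach theorem\<close>

locale ultrametric_tvs = ultrametric_field v
  for v :: "'k::local_field \<Rightarrow> real" +
  fixes smul :: "'k \<Rightarrow> 'a \<Rightarrow> 'a::{topological_ab_group_add,t2_space}"
  assumes tvs: "topological_vector_space smul"
begin

sublocale vector_space smul
  using tvs unfolding topological_vector_space_def by simp

lemma tendsto_smul:
  assumes "(c \<longlongrightarrow> c0) F" "(x \<longlongrightarrow> x0) F"
  shows "((\<lambda>n. smul (c n) (x n)) \<longlongrightarrow> smul c0 x0) F"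
proof -
  have "isCont (\<lambda>(c, x). smul c x) (c0, x0)"
    using tvs unfolding topological_vector_space_def by (simp add: continuous_on_eq_continuous_at)
  from isCont_tendsto_compose[OF this tendsto_Pair[OF assms]] show ?thesis by simp
qed

lemma pi_power_absorbs:
  assumes "open W" "0 \<in> W" obtains n where "smul (\<pi> ^ n) x \<in> W"
proof -
  have "(\<lambda>n. smul (\<pi> ^ n) x) \<longlonglongrightarrow> smul 0 x"
    by (intro tendsto_smul pi_power_tendsto tendsto_const filterlim_ident)
  then have "\<forall>\<^sub>F n in sequentially. smul (\<pi> ^ n) x \<in> W"
    using topological_tendstoD assms by fastforce
  then show ?thesis using that by (auto simp: eventually_sequentially)
qed

definition submodule :: "'a set \<Rightarrow> bool" where
  "submodule M \<longleftrightarrow> 0 \<in> M \<and> (\<forall>x\<in>M. \<forall>y\<in>M. x + y \<in> M) \<and>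
     (\<forall>c\<in>valuation_ring v. \<forall>x\<in>M. smul c x \<in> M)"

lemma submodule_0: "submodule M \<Longrightarrow> 0 \<in> M"
  and submodule_add: "submodule M \<Longrightarrow> x \<in> M \<Longrightarrow> y \<in> M \<Longrightarrow> x + y \<in> M"
  and submodule_scale: "submodule M \<Longrightarrow> x \<in> M \<Longrightarrow> v c \<le> 1 \<Longrightarrow> smul c x \<in> M"
  by (auto simp: submodule_def valuation_ring_def)

lemma submodule_diff: "submodule M \<Longrightarrow> x \<in> M \<Longrightarrow> y \<in> M \<Longrightarrow> x - y \<in> M"
  using submodule_add[of M x "- y"] submodule_scale[of M y "-1"] by simp

text \<open>\<open>d / c\<close> lies in the valuation ring. Membership of a multiple of
  \<open>x\<close> in \<open>M\<close> thus depends monotonically on the absolute value of the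
  scalar.\<close>

lemma submodule_rescale:
  assumes "submodule M" "smul c x \<in> M" "v d \<le> v c" shows "smul d x \<in> M"
proof (cases "c = 0")
  case True
  then have "d = 0" using assms(3) v_nonneg[of d] v_eq_0[of d] by simp
  then show ?thesis using submodule_0 assms by simp
next
  case False
  then have "v (d / c) \<le> 1" using assms(3) by (simp add: v_divide)
  then have "smul (d / c) (smul c x) \<in> M" using submodule_scale assms by blast
  then show ?thesis using False by simp
qed

lemma linear_functional_iff:
  "Vector_Spaces.linear smul (*) l \<longleftrightarrow>
     (\<forall>x y. l (x + y) = l x + l y) \<and> (\<forall>c x. l (smul c x) = c * l x)"
proof -
  have "vector_space ((*) :: 'k \<Rightarrow> 'k \<Rightarrow> 'k)"
    by unfold_locales (auto simp: algebra_simps)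
  then show ?thesis using vector_space_axioms by (auto simp: Vector_Spaces.linear_iff)
qed

text \<open>The polar of \<open>M\<close> in the algebraic dual. Continuity is left out: it is
  automatic for open \<open>M\<close>, so extensions and limits can be formed by pure algebra and
  estimates.\<close>

definition dominated :: "'a set \<Rightarrow> ('a \<Rightarrow> 'k) \<Rightarrow> bool" where
  "dominated M l \<longleftrightarrow> Vector_Spaces.linear smul (*) l \<and> (\<forall>x\<in>M. v (l x) \<le> 1)"

lemma dominatedD:
  assumes "dominated M l"
  shows "l (x + y) = l x + l y" "l (smul c x) = c * l x" "l (x - y) = l x - l y"
    "x \<in> M \<Longrightarrow> v (l x) \<le> 1"
proof -
  have *: "l (x + y) = l x + l y" "l (smul c x) = c * l x" for x y c
    using assms unfolding dominated_def linear_functional_iff by simp_all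
  then show "l (x + y) = l x + l y" "l (smul c x) = c * l x" by simp_all
  show "l (x - y) = l x - l y" using *(1)[of "x - y" y] by simp
  show "x \<in> M \<Longrightarrow> v (l x) \<le> 1" using assms unfolding dominated_def by simp
qed

lemma dominated_le:
  assumes "dominated M l" "smul c x \<in> M" "c \<noteq> 0" shows "v (l x) \<le> 1 / v c"
  using dominatedD(4)[OF assms(1,2)] dominatedD(2)[OF assms(1), of c x] assms(3)
  by (simp add: v_mult field_simps)

text \<open>If \<open>y - x\<close> lies in \<open>\<pi> ^ n\<close> times \<open>M\<close>, the
  values at \<open>x\<close> and \<open>y\<close> differ by at most
  \<open>v (\<pi> ^ n)\<close>.\<close>

lemma dominated_continuous:
  assumes M: "open M" "submodule M" and l: "dominated M l"
  shows "continuous_functional smul l"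
  unfolding continuous_functional_def
proof
  show "Vector_Spaces.linear smul (*) l" using l dominated_def by blast
  have "(l \<longlongrightarrow> l x) (at x)" for x
    unfolding tendsto_v_iff
  proof (intro allI impI)
    fix e :: real assume "e > 0"
    then obtain n where n: "v (\<pi> ^ n) < e" using ex_v_pi_power by blast
    have "((\<lambda>y. smul (1 / \<pi> ^ n) (y - x)) \<longlongrightarrow> smul (1 / \<pi> ^ n) (x - x)) (at x)"
      by (intro tendsto_smul tendsto_intros)
    then have "\<forall>\<^sub>F y in at x. smul (1 / \<pi> ^ n) (y - x) \<in> M"
      using topological_tendstoD M submodule_0 by fastforce
    then show "\<forall>\<^sub>F y in at x. v (l y - l x) < e"
    proof (rule eventually_mono)
      fix y assume "smul (1 / \<pi> ^ n) (y - x) \<in> M"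
      from dominated_le[OF l this] show "v (l y - l x) < e"
        using n by (simp add: dominatedD(3)[OF l] v_divide)
    qed
  qed
  then show "continuous_on UNIV l" by (simp add: continuous_on_def)
qed

text \<open>
  Hahn--Banach, with functionals represented by their graphs: a subspace \<open>G\<close> on which \<open>x \<in> M\<close> forces
  \<open>v a \<le> 1\<close> is automatically single-valued, and spherical completeness provides the value at a
  new vector.
\<close>

definition dominated_graph :: "'a set \<Rightarrow> ('a \<times> 'k) set \<Rightarrow> bool" where
  "dominated_graph M G \<longleftrightarrow> (0, 0) \<in> G \<and>
     (\<forall>x a y b. (x, a) \<in> G \<longrightarrow> (y, b) \<in> G \<longrightarrow> (x + y, a + b) \<in> G) \<and>
     (\<forall>c x a. (x, a) \<in> G \<longrightarrow> (smul c x, c * a) \<in> G) \<and>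
     (\<forall>x a. (x, a) \<in> G \<longrightarrow> x \<in> M \<longrightarrow> v a \<le> 1)"

lemma dominated_graphD:
  assumes "dominated_graph M G"
  shows "(0, 0) \<in> G" "(x, a) \<in> G \<Longrightarrow> (y, b) \<in> G \<Longrightarrow> (x + y, a + b) \<in> G"
    "(x, a) \<in> G \<Longrightarrow> (smul c x, c * a) \<in> G" "(x, a) \<in> G \<Longrightarrow> x \<in> M \<Longrightarrow> v a \<le> 1"
    "(x, a) \<in> G \<Longrightarrow> (y, b) \<in> G \<Longrightarrow> (x - y, a - b) \<in> G"
proof -
  have *: "(x, a) \<in> G \<Longrightarrow> (y, b) \<in> G \<Longrightarrow> (x + y, a + b) \<in> G"
    "(x, a) \<in> G \<Longrightarrow> (smul c x, c * a) \<in> G" for x y a b c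
    using assms unfolding dominated_graph_def by simp_all
  then show "(x, a) \<in> G \<Longrightarrow> (y, b) \<in> G \<Longrightarrow> (x + y, a + b) \<in> G"
    "(x, a) \<in> G \<Longrightarrow> (smul c x, c * a) \<in> G" by simp_all
  show "(0, 0) \<in> G" "(x, a) \<in> G \<Longrightarrow> x \<in> M \<Longrightarrow> v a \<le> 1"
    using assms unfolding dominated_graph_def by simp_all
  show "(x, a) \<in> G \<Longrightarrow> (y, b) \<in> G \<Longrightarrow> (x - y, a - b) \<in> G"
    using *(2)[of y b "-1"] *(1)[of x a "- y" "- b"] by simp
qed

text \<open>Two values at \<open>x\<close> put \<open>(0, a - b)\<close>, hence by scaling
  \<open>(0, 1 / \<pi>)\<close>, into \<open>G\<close>; but 0 is in \<open>M\<close> and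
  \<open>1 / \<pi>\<close> has absolute value above 1.\<close>

lemma dominated_graph_unique:
  assumes M: "submodule M" and G: "dominated_graph M G" and "(x, a) \<in> G" "(x, b) \<in> G"
  shows "a = b"
proof (rule ccontr)
  assume "a \<noteq> b"
  have "(0, a - b) \<in> G" using dominated_graphD(5)[OF G assms(3,4)] by simp
  from dominated_graphD(3)[OF G this, of "1 / (\<pi> * (a - b))"]
  have "v (1 / \<pi>) \<le> 1"
    using dominated_graphD(4)[OF G, of 0] submodule_0[OF M] \<open>a \<noteq> b\<close> by simp
  then show False using v_pi by (simp add: v_divide field_simps)
qed

lemma dominated_graph_extend:
  assumes M: "submodule M" and G: "dominated_graph M G"
  shows "\<exists>G' a. dominated_graph M G' \<and> G \<subseteq> G' \<and> (x, a) \<in> G'"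
proof -
  \<comment> \<open>Each triple is one constraint on the value \<open>\<alpha>\<close> at
    \<open>x\<close>: the element \<open>(s + x) / c\<close> of \<open>M\<close> must be sent to
    \<open>(b + \<alpha>) / c\<close>, so \<open>\<alpha>\<close> has to lie in the ball with centre
    \<open>- b\<close> and radius \<open>v c\<close>.\<close>
  define I where "I = {(s, b, c). (s, b) \<in> G \<and> c \<noteq> 0 \<and> smul (1 / c) (s + x) \<in> M}"
  have "\<exists>\<alpha>. \<forall>i\<in>I. v (\<alpha> - (- fst (snd i))) \<le> v (snd (snd i))"
  proof (rule spherically_complete)
    fix i j assume ij: "i \<in> I" "j \<in> I"
    \<comment> \<open>Both vectors can be divided by the \<open>c\<close> of larger absolute value
      and stay in \<open>M\<close>; their difference then lies in \<open>M\<close> and in the domain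
      of \<open>G\<close>, which is already dominated.\<close>
    have close: "v (b - b') \<le> v c"
      if "(s, b, c) \<in> I" "(s', b', c') \<in> I" "v c' \<le> v c" for s b c s' b' c'
    proof -
      have c: "c \<noteq> 0" "c' \<noteq> 0" and G12: "(s, b) \<in> G" "(s', b') \<in> G"
        and M1: "smul (1 / c) (s + x) \<in> M" and M2: "smul (1 / c') (s' + x) \<in> M"
        using that unfolding I_def by auto
      have "v (1 / c) \<le> v (1 / c')"
        using c \<open>v c' \<le> v c\<close> by (simp add: v_divide divide_left_mono)
      then have "smul (1 / c) (s' + x) \<in> M" using submodule_rescale[OF M M2] by blast
      from submodule_diff[OF M M1 this] have "smul (1 / c) (s - s') \<in> M"
        by (simp flip: scale_right_diff_distrib)
      moreover have "(smul (1 / c) (s - s'), 1 / c * (b - b')) \<in> G"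
        by (intro dominated_graphD[OF G] G12)
      ultimately have "v (1 / c * (b - b')) \<le> 1" using dominated_graphD(4)[OF G] by blast
      then show ?thesis using c by (simp add: v_mult v_divide divide_le_eq)
    qed
    show "v (- fst (snd i) - - fst (snd j)) \<le> max (v (snd (snd i))) (v (snd (snd j)))"
      using close[of "fst i" "fst (snd i)" "snd (snd i)" "fst j" "fst (snd j)" "snd (snd j)"]
        close[of "fst j" "fst (snd j)" "snd (snd j)" "fst i" "fst (snd i)" "snd (snd i)"] ij
        v_minus_commute[of "fst (snd i)" "fst (snd j)"]
      by (auto simp: max_def)
  qed simp
  then obtain \<alpha> where \<alpha>: "\<And>s b c. (s, b) \<in> G \<Longrightarrow> c \<noteq> 0 \<Longrightarrow> smul (1 / c) (s + x) \<in> M \<Longrightarrow> v (\<alpha> + b) \<le> v c"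
    unfolding I_def by fastforce
  define G' where "G' = {(s + smul d x, b + d * \<alpha>) | s b d. (s, b) \<in> G}"
  have "dominated_graph M G'"
    unfolding dominated_graph_def
  proof (intro conjI allI impI)
    show "(0, 0) \<in> G'"
      unfolding G'_def using dominated_graphD(1)[OF G] by (auto intro!: exI[of _ 0])
    show "(y + z, a + b) \<in> G'" if yz: "(y, a) \<in> G'" "(z, b) \<in> G'" for y a z b
    proof -
      from yz(1) obtain s d e where 1: "(s, e) \<in> G" "y = s + smul d x" "a = e + d * \<alpha>"
        unfolding G'_def by blast
      from yz(2) obtain s' d' e' where 2: "(s', e') \<in> G" "z = s' + smul d' x" "b = e' + d' * \<alpha>"
        unfolding G'_def by blast
      have "y + z = (s + s') + smul (d + d') x" "a + b = (e + e') + (d + d') * \<alpha>"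
        using 1 2 by (simp_all add: scale_left_distrib algebra_simps)
      then show ?thesis unfolding G'_def using dominated_graphD(2)[OF G 1(1) 2(1)] by blast
    qed
    show "(smul c y, c * a) \<in> G'" if "(y, a) \<in> G'" for c y a
    proof -
      from that obtain s d e where 1: "(s, e) \<in> G" "y = s + smul d x" "a = e + d * \<alpha>"
        unfolding G'_def by blast
      have "smul c y = smul c s + smul (c * d) x" "c * a = c * e + (c * d) * \<alpha>"
        using 1 by (simp_all add: scale_right_distrib algebra_simps)
      then show ?thesis unfolding G'_def using dominated_graphD(3)[OF G 1(1)] by blast
    qed
    show "v a \<le> 1" if "(y, a) \<in> G'" "y \<in> M" for y a
    proof -
      from that obtain s d e where 1: "(s, e) \<in> G" "y = s + smul d x" "a = e + d * \<alpha>"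
        unfolding G'_def by blast
      show ?thesis
      proof (cases "d = 0")
        case True
        then show ?thesis using 1 that(2) dominated_graphD(4)[OF G] by simp
      next
        case False
        \<comment> \<open>Dividing by \<open>d\<close> normalizes the coefficient of
          \<open>x\<close>: the constraint used has vector \<open>s / d\<close>, value
          \<open>e / d\<close> and scalar \<open>1 / d\<close>.\<close>
        have "smul (1 / (1 / d)) (smul (1 / d) s + x) = y"
          using 1 False by (simp add: scale_right_distrib)
        then have "v (\<alpha> + 1 / d * e) \<le> v (1 / d)"
          using \<alpha>[OF dominated_graphD(3)[OF G 1(1)], of "1 / d" "1 / d"] False that(2) by simp
        then have "v d * v (\<alpha> + 1 / d * e) \<le> v d * v (1 / d)" by (intro mult_left_mono) auto
        then have "v (d * (\<alpha> + 1 / d * e)) \<le> 1" using False by (simp add: v_mult v_divide)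
        moreover have "d * (\<alpha> + 1 / d * e) = a" using 1 False by (simp add: algebra_simps)
        ultimately show ?thesis by simp
      qed
    qed
  qed
  moreover have "G \<subseteq> G'" unfolding G'_def by (force intro: exI[of _ "0::'k"])
  moreover have "(x, \<alpha>) \<in> G'"
    unfolding G'_def using dominated_graphD(1)[OF G] by (force intro: exI[of _ "1::'k"])
  ultimately show ?thesis by blast
qed

text \<open>The hypothesis is domination on the line through \<open>x0\<close> (it forces
  \<open>c = 0\<close> if \<open>x0 = 0\<close>). Zorn's lemma enlarges the graph over this line,
  and a maximal graph is total by the extension to one more vector.\<close>

lemma dominated_functional_exists:
  assumes M: "submodule M" and c: "\<And>d. smul d x0 \<in> M \<Longrightarrow> v (d * c) \<le> 1"
  obtains l where "dominated M l" "l x0 = c"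
proof -
  define \<A> where "\<A> = {G. dominated_graph M G \<and> (x0, c) \<in> G}"
  have "range (\<lambda>d. (smul d x0, d * c)) \<in> \<A>"
    unfolding \<A>_def dominated_graph_def
  proof (intro CollectI conjI allI impI)
    show "(0, 0) \<in> range (\<lambda>d. (smul d x0, d * c))" by (rule image_eqI[of _ _ 0]) auto
    show "(x0, c) \<in> range (\<lambda>d. (smul d x0, d * c))" by (rule image_eqI[of _ _ 1]) auto
    fix x a
    assume "(x, a) \<in> range (\<lambda>d. (smul d x0, d * c))"
    then obtain d where d: "x = smul d x0" "a = d * c" by blast
    show "x \<in> M \<Longrightarrow> v a \<le> 1" using c d by blast
    show "(smul e x, e * a) \<in> range (\<lambda>d. (smul d x0, d * c))" for e
      using d by (intro image_eqI[of _ _ "e * d"]) auto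
    fix y b
    assume "(y, b) \<in> range (\<lambda>d. (smul d x0, d * c))"
    then obtain d' where "y = smul d' x0" "b = d' * c" by blast
    then show "(x + y, a + b) \<in> range (\<lambda>d. (smul d x0, d * c))"
      using d by (intro image_eqI[of _ _ "d + d'"]) (auto simp: scale_left_distrib algebra_simps)
  qed
  then have "\<A> \<noteq> {}" by blast
  moreover have "\<Union>\<C> \<in> \<A>" if "\<C> \<noteq> {}" and ch: "subset.chain \<A> \<C>" for \<C>
  proof -
    have sub: "\<And>G. G \<in> \<C> \<Longrightarrow> dominated_graph M G \<and> (x0, c) \<in> G"
      using ch unfolding subset.chain_def \<A>_def by blast
    have add: "(x + y, a + b) \<in> \<Union>\<C>" if xy: "(x, a) \<in> \<Union>\<C>" "(y, b) \<in> \<Union>\<C>" for x a y b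
    proof -
      obtain G H where GH: "G \<in> \<C>" "(x, a) \<in> G" "H \<in> \<C>" "(y, b) \<in> H" using xy by blast
      then obtain K where K: "K \<in> \<C>" "(x, a) \<in> K" "(y, b) \<in> K"
        using ch unfolding subset_chain_def by blast
      then have "(x + y, a + b) \<in> K" using sub dominated_graphD(2) by blast
      then show ?thesis using K by blast
    qed
    obtain G0 where G0: "G0 \<in> \<C>" using \<open>\<C> \<noteq> {}\<close> by blast
    have "dominated_graph M (\<Union>\<C>)"
      unfolding dominated_graph_def
    proof (intro conjI allI impI)
      show "(0, 0) \<in> \<Union>\<C>" using G0 sub dominated_graphD(1) by blast
      show "(x, a) \<in> \<Union>\<C> \<Longrightarrow> (y, b) \<in> \<Union>\<C> \<Longrightarrow> (x + y, a + b) \<in> \<Union>\<C>" for x a y b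
        by (rule add)
      show "(smul d x, d * a) \<in> \<Union>\<C>" if "(x, a) \<in> \<Union>\<C>" for d x a
        using that sub dominated_graphD(3) by blast
      show "v a \<le> 1" if "(x, a) \<in> \<Union>\<C>" "x \<in> M" for x a
        using that sub dominated_graphD(4) by blast
    qed
    then show ?thesis using G0 sub unfolding \<A>_def by blast
  qed
  ultimately obtain G where "G \<in> \<A>" and max: "\<And>H. H \<in> \<A> \<Longrightarrow> G \<subseteq> H \<Longrightarrow> H = G"
    using subset_Zorn_nonempty[of \<A>] by metis
  then have G: "dominated_graph M G" and x0: "(x0, c) \<in> G" unfolding \<A>_def by auto
  have total: "\<exists>a. (x, a) \<in> G" for x
  proof -
    obtain H a where H: "dominated_graph M H" "G \<subseteq> H" "(x, a) \<in> H"
      using dominated_graph_extend[OF M G] by blast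
    then have "H = G" using max x0 unfolding \<A>_def by blast
    then show ?thesis using H by blast
  qed
  define l where "l x = (SOME a. (x, a) \<in> G)" for x
  have l: "(x, l x) \<in> G" for x unfolding l_def using total by (rule someI_ex)
  have l_eq: "l x = a" if "(x, a) \<in> G" for x a
    using dominated_graph_unique[OF M G l that] .
  have "dominated M l"
    unfolding dominated_def linear_functional_iff
    using l dominated_graphD(2,3)[OF G] dominated_graphD(4)[OF G l] by (auto intro!: l_eq)
  then show ?thesis using that l_eq x0 by blast
qed

end

section \<open>Mackey's theorem by a gliding hump\<close>

section \<open>Weakly bounded sets are bounded\<close>

context ultrametric_tvs
begin

lemma dominated_add:
  assumes "dominated M l" "dominated M m" shows "dominated M (\<lambda>x. l x + m x)"
proof -
  have "v (l x + m x) \<le> 1" if "x \<in> M" for x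
    using v_add_le[of "l x" "m x"] dominatedD(4)[OF assms(1) that] dominatedD(4)[OF assms(2) that]
    by simp
  then show ?thesis
    using dominatedD(1,2)[OF assms(1)] dominatedD(1,2)[OF assms(2)]
    unfolding dominated_def linear_functional_iff by (simp add: algebra_simps)
qed

lemma dominated_scale:
  assumes "dominated M l" "v c \<le> 1" shows "dominated M (\<lambda>x. c * l x)"
  using dominatedD(1,2)[OF assms(1)] dominatedD(4)[OF assms(1)] assms(2)
  unfolding dominated_def linear_functional_iff
  by (auto simp: algebra_simps v_mult intro!: mult_le_one)

text \<open>If no power of \<open>\<pi>\<close> carries \<open>B\<close> into \<open>M\<close>,
  partial sums with increments \<open>\<pi> ^ (2 * n) * l n\<close> converge to a functional
  \<open>L\<close> in the polar of \<open>M\<close>. At \<open>b n\<close> the \<open>n\<close>-th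
  increment exceeds both the earlier sum and the remainder, so \<open>L\<close> is unbounded on
  \<open>B\<close>.\<close>

lemma weakly_bounded_imp_absorbed:
  assumes M: "open M" "submodule M"
    and wb: "\<And>l. continuous_functional smul l \<Longrightarrow> \<exists>C. \<forall>b\<in>B. v (l b) \<le> C"
  shows "\<exists>n. \<forall>b\<in>B. smul (\<pi> ^ n) b \<in> M"
proof (rule ccontr)
  assume contr: "\<not> ?thesis"
  have absorb: "\<exists>K. smul (\<pi> ^ K) x \<in> M" for x
    using pi_power_absorbs[OF M(1) submodule_0[OF M(2)]] by metis
  have bounded: "\<exists>C. \<forall>b\<in>B. v (l b) \<le> C" if "dominated M l" for l
    using wb dominated_continuous[OF M that] by blast
  \<comment> \<open>\<open>S\<close> is the sum before stage \<open>n\<close>, \<open>l\<close> the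
    functional to be added with factor \<open>\<pi> ^ (2 * n)\<close>, and \<open>b\<close> its
    witness; \<open>\<pi> ^ (2 * n) / \<pi> ^ a\<close> is the hump, the value of the new summand at
    \<open>b\<close>.\<close>
  define P where "P n s = (case s of (S, b, a, l) \<Rightarrow> dominated M S \<and> b \<in> B \<and> dominated M l \<and>
      l b = 1 / \<pi> ^ a \<and> smul (\<pi> ^ Suc a) b \<in> M \<and>
      real n < v (\<pi> ^ (2 * n) / \<pi> ^ a) \<and> v (S b) < v (\<pi> ^ (2 * n) / \<pi> ^ a))"
    for n and s :: "('a \<Rightarrow> 'k) \<times> 'a \<times> nat \<times> ('a \<Rightarrow> 'k)"
  have step: "\<exists>b a l. P n (S, b, a, l)" if S: "dominated M S" for n S
  proof -
    obtain C0 where C0: "\<And>b. b \<in> B \<Longrightarrow> v (S b) \<le> C0" using bounded[OF S] by blast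
    define C where "C = max C0 (real n)"
    have C: "C \<ge> 0" "real n \<le> C" "\<And>b. b \<in> B \<Longrightarrow> v (S b) \<le> C"
      using C0 unfolding C_def by (auto simp: max.coboundedI1)
    \<comment> \<open>\<open>N\<close> is chosen so that an exponent \<open>a \<ge> N\<close> makes
      the hump larger than \<open>C + 1\<close>, hence larger than \<open>n\<close> and than
      \<open>S\<close> on \<open>B\<close>.\<close>
    have "0 < v (\<pi> ^ (2 * n)) / (C + 1)" using C(1) by (intro divide_pos_pos) auto
    then obtain N where N: "v (\<pi> ^ N) < v (\<pi> ^ (2 * n)) / (C + 1)" using ex_v_pi_power by blast
    obtain b where b: "b \<in> B" "smul (\<pi> ^ N) b \<notin> M" using contr by blast
    \<comment> \<open>The least exponent exceeds \<open>N\<close>, so the subtraction is genuine: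
      \<open>a\<close> is the last exponent that leaves \<open>b\<close> outside \<open>M\<close>.
      This is what allows a dominated functional the value \<open>1 / \<pi> ^ a\<close> at
      \<open>b\<close>.\<close>
    define a where "a = (LEAST K. smul (\<pi> ^ K) b \<in> M) - 1"
    have least: "smul (\<pi> ^ (LEAST K. smul (\<pi> ^ K) b \<in> M)) b \<in> M"
      using absorb by (rule LeastI_ex)
    have "N < (LEAST K. smul (\<pi> ^ K) b \<in> M)"
    proof (rule ccontr)
      assume "\<not> ?thesis"
      then have "v (\<pi> ^ N) \<le> v (\<pi> ^ (LEAST K. smul (\<pi> ^ K) b \<in> M))"
        unfolding v_power using v_pi by (intro power_decreasing) auto
      then show False using submodule_rescale[OF M(2) least] b by blast
    qed
    then have a: "Suc a = (LEAST K. smul (\<pi> ^ K) b \<in> M)" "N \<le> a" unfolding a_def by auto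
    have in_M: "smul (\<pi> ^ Suc a) b \<in> M" using least a by simp
    have notin_M: "smul (\<pi> ^ a) b \<notin> M"
      using not_less_Least[of a "\<lambda>K. smul (\<pi> ^ K) b \<in> M"] a(1) by simp
    obtain l where l: "dominated M l" "l b = 1 / \<pi> ^ a"
    proof (rule dominated_functional_exists[OF M(2), of b "1 / \<pi> ^ a"])
      fix d assume d: "smul d b \<in> M"
      have "v d \<le> v (\<pi> ^ a)"
        using submodule_rescale[OF M(2) d, of "\<pi> ^ a"] notin_M by linarith
      then show "v (d * (1 / \<pi> ^ a)) \<le> 1" by (simp add: v_mult v_divide divide_le_eq)
    qed
    have "v (\<pi> ^ a) \<le> v (\<pi> ^ N)"
      unfolding v_power using v_pi a by (intro power_decreasing) auto
    then have "v (\<pi> ^ a) < v (\<pi> ^ (2 * n)) / (C + 1)" using N by linarith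
    moreover have "0 < v (\<pi> ^ a)" by simp
    ultimately have "C + 1 < v (\<pi> ^ (2 * n) / \<pi> ^ a)"
      using C(1) by (simp add: v_divide field_simps del: v_pos_iff)
    then have "real n < v (\<pi> ^ (2 * n) / \<pi> ^ a)" "v (S b) < v (\<pi> ^ (2 * n) / \<pi> ^ a)"
      using C(2) C(3)[OF b(1)] by linarith+
    then show ?thesis unfolding P_def using S b l in_M by auto
  qed
  define Q where "Q n s s' = (\<forall>x. fst s' x = fst s x + \<pi> ^ (2 * n) * snd (snd (snd s)) x)"
    for n :: nat and s s' :: "('a \<Rightarrow> 'k) \<times> 'a \<times> nat \<times> ('a \<Rightarrow> 'k)"
  have small: "v (\<pi> ^ m) \<le> 1" for m
    unfolding v_power using v_pi by (intro power_le_one) auto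
  have "\<exists>s. \<forall>n. P n (s n) \<and> Q n (s n) (s (Suc n))"
  proof (rule dependent_nat_choice)
    have "dominated M (\<lambda>_. 0)" unfolding dominated_def linear_functional_iff by simp
    then show "\<exists>s. P 0 s" using step by blast
    fix s n assume s: "P n s"
    obtain S b a l where [simp]: "s = (S, b, a, l)" by (cases s)
    have "dominated M S" "dominated M l" using s unfolding P_def by auto
    then have "dominated M (\<lambda>x. S x + \<pi> ^ (2 * n) * l x)"
      by (intro dominated_add dominated_scale small)
    from step[OF this] show "\<exists>s'. P (Suc n) s' \<and> Q n s s'" unfolding Q_def by fastforce
  qed
  then obtain s where s: "\<And>n. P n (s n)" "\<And>n. Q n (s n) (s (Suc n))" by blast
  define S where "S n = fst (s n)" for n
  define b where "b n = fst (snd (s n))" for n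
  define a where "a n = fst (snd (snd (s n)))" for n
  define l where "l n = snd (snd (snd (s n)))" for n
  have s_eq: "s n = (S n, b n, a n, l n)" for n by (simp add: S_def b_def a_def l_def)
  have Sd: "dominated M (S n)" and b: "b n \<in> B" and ld: "dominated M (l n)"
    and lb: "l n (b n) = 1 / \<pi> ^ a n" and bM: "smul (\<pi> ^ Suc (a n)) (b n) \<in> M"
    and large: "real n < v (\<pi> ^ (2 * n) / \<pi> ^ a n)" "v (S n (b n)) < v (\<pi> ^ (2 * n) / \<pi> ^ a n)" for n
    using s(1)[of n] unfolding P_def s_eq by auto
  have S_Suc: "S (Suc n) x = S n x + \<pi> ^ (2 * n) * l n x" for n x
    using s(2)[of n] unfolding Q_def S_def l_def by simp
  \<comment> \<open>Every increment from stage \<open>i\<close> on obeys the same bound, and the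
    ultrametric inequality passes it to their sum.\<close>
  have tail: "v (S j x - S i x) \<le> v (\<pi> ^ (2 * i) / \<pi> ^ K)"
    if "i \<le> j" "smul (\<pi> ^ K) x \<in> M" for i j K x
    using that(1)
  proof (induction j rule: dec_induct)
    case (step m)
    have "v (\<pi> ^ (2 * m) * l m x) = v (\<pi> ^ (2 * m)) * v (l m x)" by (rule v_mult)
    also have "\<dots> \<le> v (\<pi> ^ (2 * i)) * (1 / v (\<pi> ^ K))"
    proof (intro mult_mono)
      show "v (\<pi> ^ (2 * m)) \<le> v (\<pi> ^ (2 * i))"
        unfolding v_power using v_pi step by (intro power_decreasing) auto
      show "v (l m x) \<le> 1 / v (\<pi> ^ K)" by (rule dominated_le[OF ld that(2)]) simp
    qed auto
    also have "\<dots> = v (\<pi> ^ (2 * i) / \<pi> ^ K)" by (simp add: v_divide)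
    finally have 1: "v (\<pi> ^ (2 * m) * l m x) \<le> v (\<pi> ^ (2 * i) / \<pi> ^ K)" .
    have eq: "S (Suc m) x - S i x = (S m x - S i x) + \<pi> ^ (2 * m) * l m x"
      by (simp add: S_Suc)
    show ?case
      unfolding eq using v_add_le[of "S m x - S i x" "\<pi> ^ (2 * m) * l m x"] 1 step.IH by simp
  qed simp
  \<comment> \<open>The limit is obtained as a common point of the balls from \<open>tail\<close>.
    All stages and all admissible exponents are imposed at once, so the error bound for each of them
    comes with the limit.\<close>
  have limit: "\<exists>y. \<forall>i\<in>UNIV \<times> {K. smul (\<pi> ^ K) x \<in> M}.
      v (y - S (fst i) x) \<le> v (\<pi> ^ (2 * fst i) / \<pi> ^ snd i)" for x
  proof (rule spherically_complete)
    fix i j :: "nat \<times> nat"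
    assume "i \<in> UNIV \<times> {K. smul (\<pi> ^ K) x \<in> M}" "j \<in> UNIV \<times> {K. smul (\<pi> ^ K) x \<in> M}"
    then have *: "smul (\<pi> ^ snd i) x \<in> M" "smul (\<pi> ^ snd j) x \<in> M" by auto
    show "v (S (fst i) x - S (fst j) x)
        \<le> max (v (\<pi> ^ (2 * fst i) / \<pi> ^ snd i)) (v (\<pi> ^ (2 * fst j) / \<pi> ^ snd j))"
    proof (cases "fst i \<le> fst j")
      case True
      from tail[OF this *(1)] show ?thesis
        unfolding v_minus_commute[of "S (fst i) x" "S (fst j) x"] by (rule max.coboundedI1)
    next
      case False
      then have "fst j \<le> fst i" by simp
      from tail[OF this *(2)] show ?thesis by (rule max.coboundedI2)
    qed
  qed simp
  have "\<exists>y. \<forall>n K. smul (\<pi> ^ K) x \<in> M \<longrightarrow> v (y - S n x) \<le> v (\<pi> ^ (2 * n) / \<pi> ^ K)" for x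
  proof -
    from limit[of x] obtain y where y: "\<And>i. i \<in> UNIV \<times> {K. smul (\<pi> ^ K) x \<in> M} \<Longrightarrow>
      v (y - S (fst i) x) \<le> v (\<pi> ^ (2 * fst i) / \<pi> ^ snd i)" by blast
    have "v (y - S n x) \<le> v (\<pi> ^ (2 * n) / \<pi> ^ K)" if "smul (\<pi> ^ K) x \<in> M" for n K
      using y[of "(n, K)"] that by simp
    then show ?thesis by blast
  qed
  then obtain L where L: "\<And>x n K. smul (\<pi> ^ K) x \<in> M \<Longrightarrow> v (L x - S n x) \<le> v (\<pi> ^ (2 * n) / \<pi> ^ K)"
    by metis
  have S_L: "(\<lambda>n. S n x) \<longlonglongrightarrow> L x" for x
    unfolding tendsto_v_iff
  proof (intro allI impI)
    fix e :: real assume e: "e > 0"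
    obtain K where K: "smul (\<pi> ^ K) x \<in> M" using absorb by blast
    have "filterlim (\<lambda>n::nat. 2 * n) at_top sequentially"
      by (rule filterlim_subseq) (simp add: strict_mono_def)
    then have "(\<lambda>n. v (\<pi> ^ (2 * n)) / v (\<pi> ^ K)) \<longlonglongrightarrow> 0 / v (\<pi> ^ K)"
      by (intro tendsto_divide filterlim_compose[OF v_pi_power_tendsto] tendsto_const) auto
    then have "\<forall>\<^sub>F n in sequentially. v (\<pi> ^ (2 * n)) / v (\<pi> ^ K) < e"
      using e order_tendstoD(2) by fastforce
    then show "\<forall>\<^sub>F n in sequentially. v (S n x - L x) < e"
    proof (rule eventually_mono)
      fix n assume "v (\<pi> ^ (2 * n)) / v (\<pi> ^ K) < e"
      then show "v (S n x - L x) < e"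
        using L[OF K, of n] v_minus_commute[of "L x" "S n x"] by (simp add: v_divide)
    qed
  qed
  have "dominated M L"
    unfolding dominated_def linear_functional_iff
  proof (intro conjI allI ballI)
    fix x y c
    have "(\<lambda>n. S n (x + y)) \<longlonglongrightarrow> L x + L y"
      unfolding dominatedD(1)[OF Sd] by (intro tendsto_add S_L)
    then show "L (x + y) = L x + L y" using S_L LIMSEQ_unique by blast
    have "(\<lambda>n. S n (smul c x)) \<longlonglongrightarrow> c * L x"
      unfolding dominatedD(2)[OF Sd] by (intro tendsto_mult S_L tendsto_const)
    then show "L (smul c x) = c * L x" using S_L LIMSEQ_unique by blast
  next
    fix x assume x: "x \<in> M"
    then have "v (L x - S 0 x) \<le> 1" using L[of 0 x 0] by simp
    then show "v (L x) \<le> 1"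
      using v_add_le[of "L x - S 0 x" "S 0 x"] dominatedD(4)[OF Sd x, of 0] by simp
  qed
  then obtain C where C: "\<And>x. x \<in> B \<Longrightarrow> v (L x) \<le> C" using bounded by blast
  obtain n where n: "C \<le> real n" using real_arch_simple by blast
  let ?t = "\<pi> ^ (2 * n) / \<pi> ^ a n"
  have S1: "S (Suc n) (b n) = S n (b n) + ?t" by (simp add: S_Suc lb)
  \<comment> \<open>The factor 2 in the exponents pays off here: the known exponent
    \<open>Suc (a n)\<close> for \<open>b n\<close> costs a factor \<open>1 / v \<pi>\<close>, the
    next stage gains \<open>v \<pi> ^ 2\<close>, and the net factor \<open>v \<pi>\<close> puts the
    remainder strictly below the hump.\<close>
  have "v (L (b n) - S (Suc n) (b n)) \<le> v (\<pi> ^ (2 * Suc n) / \<pi> ^ Suc (a n))" by (rule L[OF bM])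
  also have "\<dots> = v \<pi> * v ?t" by (simp add: v_mult v_divide v_power)
  also have "\<dots> < v ?t" using v_pi by simp
  finally have 1: "v (L (b n) - S (Suc n) (b n)) < v ?t" .
  have "v (S (Suc n) (b n)) \<le> max (v (L (b n))) (v (L (b n) - S (Suc n) (b n)))"
    using v_diff_le[of "L (b n)" "L (b n) - S (Suc n) (b n)"] by simp
  moreover have "v ?t \<le> max (v (S (Suc n) (b n))) (v (S n (b n)))"
    using v_diff_le[of "S (Suc n) (b n)" "S n (b n)"] by (simp add: S1)
  ultimately have "v ?t \<le> v (L (b n))"
    using 1 large(2)[of n] unfolding le_max_iff_disj by linarith
  then show False using C[OF b, of n] n large(1)[of n] by linarith
qed

end

locale locally_convex_tvs = ultrametric_tvs v smul
  for v :: "'k::local_field \<Rightarrow> real" and smul :: "'k \<Rightarrow> 'a \<Rightarrow> 'a::{topological_ab_group_add,t2_space}" +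
  assumes locally_convex: "locally_convex v smul"
begin

lemma submodule_nhd:
  assumes "open W" "0 \<in> W" obtains M where "open M" "submodule M" "M \<subseteq> W"
  using locally_convex assms unfolding locally_convex_def submodule_def by metis

lemma weakly_bounded_imp_bounded:
  assumes wb: "\<And>l. continuous_functional smul l \<Longrightarrow> \<exists>C. \<forall>b\<in>B. v (l b) \<le> C"
  shows "bounded_set smul B"
  unfolding bounded_set_def
proof (intro allI impI, elim conjE)
  fix W assume "open W" "(0::'a) \<in> W"
  then obtain M where M: "open M" "submodule M" "M \<subseteq> W" by (rule submodule_nhd)
  obtain n where n: "\<And>b. b \<in> B \<Longrightarrow> smul (\<pi> ^ n) b \<in> M"
    using weakly_bounded_imp_absorbed[OF M(1,2) wb] by blast
  have "b \<in> smul (1 / \<pi> ^ n) ` W" if "b \<in> B" for b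
    using n[OF that] M(3) by (intro image_eqI[of _ _ "smul (\<pi> ^ n) b"]) auto
  then show "\<exists>c. c \<noteq> 0 \<and> B \<subseteq> smul c ` W" by (intro exI[of _ "1 / \<pi> ^ n"]) auto
qed

lemma bounded_scaled_tendsto_0:
  assumes B: "bounded_set smul B" "\<And>n. z n \<in> B" and t: "(t \<longlongrightarrow> 0) F"
  shows "((\<lambda>n. smul (t n) (z n)) \<longlongrightarrow> 0) F"
proof (rule topological_tendstoI)
  fix W assume "open W" "(0::'a) \<in> W"
  then obtain M where M: "open M" "submodule M" "M \<subseteq> W" by (rule submodule_nhd)
  obtain c where c: "c \<noteq> 0" "B \<subseteq> smul c ` M"
    using B(1)[unfolded bounded_set_def, rule_format, of M] M(1) submodule_0[OF M(2)] by metis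
  have "\<forall>\<^sub>F n in F. v (t n) < 1 / v c"
    using t c(1) unfolding tendsto_v_zero_iff by simp
  then show "\<forall>\<^sub>F n in F. smul (t n) (z n) \<in> W"
  proof (rule eventually_mono)
    fix n assume t: "v (t n) < 1 / v c"
    obtain m where "m \<in> M" "z n = smul c m" using B(2) c(2) by blast
    moreover have "v (t n * c) \<le> 1" using t c(1) by (simp add: v_mult field_simps)
    ultimately show "smul (t n) (z n) \<in> W" using submodule_scale[OF M(2)] M(3) by auto
  qed
qed

end

section \<open>Sequential description of the iterated spaces\<close>

section \<open>Convergence in the iterated spaces\<close>

lemma continuous_map_sequentially:
  assumes X: "metrizable_space X"
    and lim: "\<And>p x. (\<And>n::nat. p n \<in> topspace X) \<Longrightarrow> limitin X p x sequentially \<Longrightarrow> (\<lambda>n. f (p n)) \<longlonglongrightarrow> f x"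
  shows "continuous_map X euclidean f"
proof -
  obtain S d where "Metric_space S d" and X_eq: "X = Metric_space.mtopology S d"
    using X unfolding metrizable_space_def by blast
  interpret Metric_space S d by fact
  have "openin X {x \<in> topspace X. f x \<in> V}" if V: "open V" for V
    unfolding X_eq openin_mtopology topspace_mtopology
  proof (intro conjI allI impI)
    fix x assume x: "x \<in> {x \<in> S. f x \<in> V}"
    show "\<exists>r>0. mball x r \<subseteq> {x \<in> S. f x \<in> V}"
    proof (rule ccontr)
      assume contr: "\<not> ?thesis"
      have "\<exists>y. y \<in> mball x (inverse (real (Suc n))) \<and> f y \<notin> V" for n
      proof (rule ccontr)
        assume "\<not> ?thesis"
        then have "mball x (inverse (real (Suc n))) \<subseteq> {x \<in> S. f x \<in> V}" by auto
        then show False using contr inverse_positive_iff_positive[of "real (Suc n)"] by (metis of_nat_0_less_iff zero_less_Suc)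
      qed
      then obtain p where p: "\<And>n. p n \<in> mball x (inverse (real (Suc n)))" "\<And>n. f (p n) \<notin> V"
        by metis
      have "limitin X p x sequentially"
        unfolding X_eq limitin_metric
      proof (intro conjI allI impI)
        fix e :: real assume "e > 0"
        then have "\<forall>\<^sub>F n in sequentially. inverse (real (Suc n)) < e"
          using order_tendstoD(2)[OF LIMSEQ_inverse_real_of_nat] by simp
        then show "\<forall>\<^sub>F n in sequentially. p n \<in> S \<and> d (p n) x < e"
        proof (rule eventually_mono)
          fix n assume "inverse (real (Suc n)) < e"
          then show "p n \<in> S \<and> d (p n) x < e"
            using p(1)[of n] commute[of x "p n"] unfolding mball_def by simp
        qed
      qed (use x in simp)
      moreover have "p n \<in> topspace X" for n using p(1)[of n] unfolding X_eq by simp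
      ultimately have "(\<lambda>n. f (p n)) \<longlonglongrightarrow> f x" by (intro lim)
      from topological_tendstoD[OF this V] have "\<forall>\<^sub>F n in sequentially. f (p n) \<in> V" using x by simp
      then show False using p(2) by simp
    qed
  qed auto
  then show ?thesis unfolding continuous_map_def by simp
qed

lemma limitin_pullback_topology:
  assumes "x \<in> A" "\<And>n. p n \<in> A"
  shows "limitin (pullback_topology A f T) p x F \<longleftrightarrow> limitin T (\<lambda>n. f (p n)) (f x) F"
proof
  assume lim: "limitin (pullback_topology A f T) p x F"
  show "limitin T (\<lambda>n. f (p n)) (f x) F"
    unfolding limitin_def
  proof (intro conjI allI impI)
    show "f x \<in> topspace T"
      using limitin_topspace[OF lim] unfolding topspace_pullback_topology by simp
    fix W assume W: "openin T W \<and> f x \<in> W"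
    then have "openin (pullback_topology A f T) (f -` W \<inter> A)"
      unfolding openin_pullback_topology by blast
    from limitinD[OF lim this] show "\<forall>\<^sub>F n in F. f (p n) \<in> W"
      using W assms by simp
  qed
next
  assume lim: "limitin T (\<lambda>n. f (p n)) (f x) F"
  show "limitin (pullback_topology A f T) p x F"
    unfolding limitin_def
  proof (intro conjI allI impI)
    show "x \<in> topspace (pullback_topology A f T)"
      using limitin_topspace[OF lim] assms unfolding topspace_pullback_topology by simp
    fix V assume V: "openin (pullback_topology A f T) V \<and> x \<in> V"
    then obtain W where W: "openin T W" "V = f -` W \<inter> A"
      unfolding openin_pullback_topology by blast
    from limitinD[OF lim W(1)] show "\<forall>\<^sub>F n in F. p n \<in> V"
      using V W(2) assms by simp
  qed
qed

lemma metrizable_pullback_topology: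
  assumes "metrizable_space T" "inj_on f A" "f ` A = topspace T"
  shows "metrizable_space (pullback_topology A f T)"
proof -
  let ?g = "inv_into A f"
  have g: "f (?g y) = y" "?g y \<in> A" if "y \<in> topspace T" for y
    using that assms(3) by (auto simp: f_inv_into_f inv_into_into)
  have "homeomorphic_maps (pullback_topology A f T) T f ?g"
    unfolding homeomorphic_maps_def
  proof (intro conjI ballI)
    show "continuous_map (pullback_topology A f T) T f"
      using continuous_map_pullback[OF continuous_map_id, of A f T] by simp
    show "continuous_map T (pullback_topology A f T) ?g"
    proof (rule continuous_map_pullback')
      show "continuous_map T T (f \<circ> ?g)"
        by (rule continuous_map_eq[OF continuous_map_id]) (simp add: g)
      show "topspace T \<subseteq> ?g -` A" using g by auto
    qed
    show "?g (f x) = x" if "x \<in> topspace (pullback_topology A f T)" for x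
      using that assms(2) unfolding topspace_pullback_topology by simp
  qed (simp add: g)
  then show ?thesis
    using assms(1) homeomorphic_metrizable_space homeomorphic_space_def by blast
qed

lemma topspace_level_topology: "topspace (level_topology j) = level_space j"
  by (induction j) (auto simp: topspace_pullback_topology)

text \<open>This makes continuity at every level a matter of sequences.\<close>

lemma metrizable_level_topology:
  assumes "metrizable_space (euclidean :: 'k::topological_space topology)"
    and "metrizable_space (euclidean :: 'e::topological_space topology)"
  shows "metrizable_space (level_topology j :: ('k, 'e) point topology)"
proof (induction j)
  case 0
  show ?case
    unfolding level_topology.simps
    by (rule metrizable_pullback_topology) (use assms in \<open>auto simp: inj_on_def image_image\<close>)
next
  case (Suc j)
  show ?case
    unfolding level_topology.simps
  proof (rule metrizable_pullback_topology)
    show "metrizable_space (prod_topology (level_topology j) (prod_topology (level_topology j) euclidean)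
            :: (('k, 'e) point \<times> ('k, 'e) point \<times> 'k) topology)"
      using Suc assms by (simp add: metrizable_space_prod_topology)
    show "(\<lambda>p. (ext_pt p, ext_dir p, ext_par p)) ` level_space (Suc j) =
        topspace (prod_topology (level_topology j) (prod_topology (level_topology j) euclidean)
            :: (('k, 'e) point \<times> ('k, 'e) point \<times> 'k) topology)"
      by (force simp: topspace_level_topology image_iff)
  qed (auto simp: inj_on_def)
qed

text \<open>Membership of all terms is built in, so that they share one constructor shape and the
  simp rules below can reduce convergence to base and scalar components.\<close>

definition level_lim ::
  "nat \<Rightarrow> (nat \<Rightarrow> ('k::topological_space, 'e::topological_space) point) \<Rightarrow> ('k, 'e) point \<Rightarrow> bool" where
  "level_lim j p x \<longleftrightarrow> (\<forall>n. p n \<in> level_space j) \<and> x \<in> level_space j \<and>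
     limitin (level_topology j) p x sequentially"

lemma level_lim_Base [simp]: "level_lim 0 (\<lambda>n. Base (e n)) (Base e0) \<longleftrightarrow> e \<longlonglongrightarrow> e0"
  unfolding level_lim_def level_topology.simps by (subst limitin_pullback_topology) auto

lemma level_lim_Ext [simp]:
  "level_lim (Suc j) (\<lambda>n. Ext (a n) (b n) (c n)) (Ext a0 b0 c0) \<longleftrightarrow>
     level_lim j a a0 \<and> level_lim j b b0 \<and> c \<longlonglongrightarrow> c0"
proof (cases "(\<forall>n. a n \<in> level_space j \<and> b n \<in> level_space j) \<and> a0 \<in> level_space j \<and> b0 \<in> level_space j")
  case True
  then have "limitin (level_topology (Suc j)) (\<lambda>n. Ext (a n) (b n) (c n)) (Ext a0 b0 c0) sequentially \<longleftrightarrow>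
    limitin (level_topology j) a a0 sequentially \<and> limitin (level_topology j) b b0 sequentially \<and> c \<longlonglongrightarrow> c0"
    unfolding level_topology.simps
    by (subst limitin_pullback_topology) (auto simp: limitin_pairwise o_def)
  then show ?thesis using True unfolding level_lim_def by auto
next
  case False
  then show ?thesis unfolding level_lim_def by auto
qed

lemma level_lim_0E:
  assumes "level_lim 0 p x"
  obtains e e0 where "p = (\<lambda>n. Base (e n))" "x = Base e0" "e \<longlonglongrightarrow> e0"
proof -
  have "\<forall>n. \<exists>e. p n = Base e" "\<exists>e. x = Base e"
    using assms unfolding level_lim_def by auto
  then obtain e e0 where e: "\<forall>n. p n = Base (e n)" and x: "x = Base e0" by metis
  from e have p: "p = (\<lambda>n. Base (e n))" by blast
  show ?thesis using that[OF p x] assms unfolding p x level_lim_Base by simp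
qed

lemma level_lim_SucE:
  assumes "level_lim (Suc j) p x"
  obtains a b c a0 b0 c0 where "p = (\<lambda>n. Ext (a n) (b n) (c n))" "x = Ext a0 b0 c0"
    "level_lim j a a0" "level_lim j b b0" "c \<longlonglongrightarrow> c0"
proof -
  have "\<forall>n. \<exists>a b c. p n = Ext a b c" "\<exists>a b c. x = Ext a b c"
    using assms unfolding level_lim_def by fastforce+
  then obtain a b c a0 b0 c0 where e: "\<forall>n. p n = Ext (a n) (b n) (c n)" and x: "x = Ext a0 b0 c0" by metis
  from e have p: "p = (\<lambda>n. Ext (a n) (b n) (c n))" by blast
  show ?thesis using that[OF p x] assms unfolding p x level_lim_Ext by simp
qed

lemma level_lim_space: "level_lim j p x \<Longrightarrow> p n \<in> level_space j" "level_lim j p x \<Longrightarrow> x \<in> level_space j"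
  unfolding level_lim_def by auto

lemma level_lim_const: "x \<in> level_space j \<Longrightarrow> level_lim j (\<lambda>_. x) x"
  unfolding level_lim_def by (simp add: topspace_level_topology)

text \<open>Serves as the limit of null sequences of directions and as padding in a direction that
  moves only a scalar parameter.\<close>

primrec level_zero :: "nat \<Rightarrow> ('k::zero, 'e::zero) point" where
  "level_zero 0 = Base 0"
| "level_zero (Suc j) = Ext (level_zero j) (level_zero j) 0"

lemma level_zero_space [simp]: "level_zero j \<in> level_space j"
  by (induction j) auto

lemma iter_domain_subset: "x \<in> iter_domain s U j \<Longrightarrow> x \<in> level_space j"
  by (induction j arbitrary: x) auto

lemma level_lim_add:
  fixes p q :: "nat \<Rightarrow> ('k::topological_monoid_add, 'e::topological_monoid_add) point"
  shows "level_lim j p x \<Longrightarrow> level_lim j q y \<Longrightarrow> level_lim j (\<lambda>n. point_add (p n) (q n)) (point_add x y)"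
  by (induction j arbitrary: p q x y) (auto elim!: level_lim_0E level_lim_SucE intro!: tendsto_add)

context ultrametric_field
begin

lemma field_tvs: "ultrametric_tvs v (*)"
proof unfold_locales
  have "vector_space ((*) :: 'k \<Rightarrow> 'k \<Rightarrow> 'k)" by unfold_locales (auto simp: algebra_simps)
  moreover have "continuous_on UNIV (\<lambda>(c, x). c * x :: 'k)"
    unfolding continuous_on_def case_prod_beta
    by (intro ballI tendsto_mult tendsto_fst tendsto_snd tendsto_ident_at)
  ultimately show "topological_vector_space ((*) :: 'k \<Rightarrow> 'k \<Rightarrow> 'k)"
    unfolding topological_vector_space_def by simp
qed

end

section \<open>Vector operations and rates of convergence on the iterated spaces\<close>

context ultrametric_tvs
begin

lemma level_lim_scale:
  assumes "t \<longlonglongrightarrow> t0"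
  shows "level_lim j p x \<Longrightarrow> level_lim j (\<lambda>n. point_scale smul (t n) (p n)) (point_scale smul t0 x)"
  by (induction j arbitrary: p x)
    (auto elim!: level_lim_0E level_lim_SucE intro!: tendsto_smul tendsto_mult assms)

lemma point_add_scale_zero [simp]:
  "x \<in> level_space j \<Longrightarrow> point_add x (point_scale smul c (level_zero j)) = x"
  by (induction j arbitrary: x) auto

lemma iter_domain_zero:
  "x \<in> iter_domain smul U j \<Longrightarrow> Ext x (level_zero j) t \<in> iter_domain smul U (Suc j)"
  using iter_domain_subset[of x smul U j] by auto

text \<open>Sequential form of openness of the iterated domains: at a successor level the base point
  and the shifted point both converge, by continuity of the vector operations.\<close>

lemma iter_domain_eventually:
  assumes U: "open U"
  shows "level_lim j p x \<Longrightarrow> x \<in> iter_domain smul U j \<Longrightarrow>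
    \<forall>\<^sub>F n in sequentially. p n \<in> iter_domain smul U j"
proof (induction j arbitrary: p x)
  case 0
  from 0(1) obtain e e0 where [simp]: "p = (\<lambda>n. Base (e n))" "x = Base e0" and e: "e \<longlonglongrightarrow> e0"
    by (rule level_lim_0E)
  have "e0 \<in> U" using 0(2) by auto
  then have "\<forall>\<^sub>F n in sequentially. e n \<in> U" using topological_tendstoD[OF e U] by simp
  then show ?case by (rule eventually_mono) simp
next
  case (Suc j)
  from Suc(2) obtain a b c a0 b0 c0 where [simp]: "p = (\<lambda>n. Ext (a n) (b n) (c n))" "x = Ext a0 b0 c0"
    and lim: "level_lim j a a0" "level_lim j b b0" "c \<longlonglongrightarrow> c0"
    by (rule level_lim_SucE)
  have "\<forall>\<^sub>F n in sequentially. a n \<in> iter_domain smul U j" using Suc lim by auto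
  moreover have "\<forall>\<^sub>F n in sequentially. point_add (a n) (point_scale smul (c n) (b n)) \<in> iter_domain smul U j"
    by (rule Suc.IH[OF level_lim_add[OF lim(1) level_lim_scale[OF lim(3,2)]]]) (use Suc.prems in auto)
  ultimately show ?case
    by (rule eventually_elim2) (use level_lim_space(1)[OF lim(2)] in auto)
qed

lemma null_sequence_rate:
  assumes metr: "metrizable_space (euclidean :: 'a topology)" and x: "x \<longlonglongrightarrow> 0"
  shows "\<exists>a. filterlim a at_top sequentially \<and>
    (\<forall>b. filterlim b at_top sequentially \<longrightarrow> (\<forall>n. b n \<le> a n) \<longrightarrow>
      (\<lambda>n. smul (1 / \<pi> ^ b n) (x n)) \<longlonglongrightarrow> 0)"
proof -
  obtain S d where "Metric_space S d" and top: "(euclidean :: 'a topology) = Metric_space.mtopology S d"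
    using metr unfolding metrizable_space_def by blast
  interpret Metric_space S d by fact
  have S: "S = UNIV" using topspace_mtopology unfolding top[symmetric] by simp
  have lim_iff: "y \<longlonglongrightarrow> 0 \<longleftrightarrow> (\<forall>e>0. \<forall>\<^sub>F n in sequentially. d (y n) 0 < e)" for y
    using limitin_metric[of y 0 sequentially] unfolding top[symmetric] by (simp add: S)
  have "\<forall>m. \<exists>N. \<forall>n\<ge>N. d (smul (1 / \<pi> ^ m) (x n)) 0 < inverse (real (Suc m))"
  proof
    fix m
    have "(\<lambda>n. smul (1 / \<pi> ^ m) (x n)) \<longlonglongrightarrow> smul (1 / \<pi> ^ m) 0"
      by (intro tendsto_smul x tendsto_const)
    then have "\<forall>\<^sub>F n in sequentially. d (smul (1 / \<pi> ^ m) (x n)) 0 < inverse (real (Suc m))"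
      using lim_iff by simp
    then show "\<exists>N. \<forall>n\<ge>N. d (smul (1 / \<pi> ^ m) (x n)) 0 < inverse (real (Suc m))"
      by (simp add: eventually_sequentially)
  qed
  then obtain N' where N': "\<And>m n. n \<ge> N' m \<Longrightarrow> d (smul (1 / \<pi> ^ m) (x n)) 0 < inverse (real (Suc m))"
    by metis
  \<comment> \<open>Summation makes the thresholds monotone: passing the one for \<open>a n\<close>
    then includes the one for a smaller \<open>b n\<close>.\<close>
  define N where "N m = (\<Sum>i\<le>m. N' i)" for m
  have N: "d (smul (1 / \<pi> ^ m) (x n)) 0 < inverse (real (Suc m))" if "n \<ge> N m" for m n
  proof (rule N')
    have "N' m \<le> N m" unfolding N_def by (rule member_le_sum) auto
    then show "N' m \<le> n" using that by simp
  qed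
  have mono: "N i \<le> N m" if "i \<le> m" for i m
    unfolding N_def using that by (intro sum_mono2) auto
  \<comment> \<open>The largest exponent whose threshold \<open>n\<close> has passed;
    \<open>m \<le> n\<close> keeps the set finite, and 0 keeps it nonempty.\<close>
  define a where "a n = Max (insert 0 {m. m \<le> n \<and> N m \<le> n})" for n
  have a_ge: "m \<le> a n" if "m \<le> n" "N m \<le> n" for m n
    unfolding a_def using that by (intro Max_ge) auto
  have N_a: "N (a n) \<le> n" if "N 0 \<le> n" for n
  proof -
    have "a n \<in> insert 0 {m. m \<le> n \<and> N m \<le> n}"
      unfolding a_def by (rule Max_in) auto
    then show ?thesis using that by auto
  qed
  have "filterlim a at_top sequentially"
    unfolding filterlim_at_top
  proof
    fix Z
    have "\<forall>\<^sub>F n in sequentially. max Z (N Z) \<le> n" by (rule eventually_ge_at_top)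
    then show "\<forall>\<^sub>F n in sequentially. Z \<le> a n" by (rule eventually_mono) (simp add: a_ge)
  qed
  moreover have "(\<lambda>n. smul (1 / \<pi> ^ b n) (x n)) \<longlonglongrightarrow> 0"
    if b: "filterlim b at_top sequentially" "\<And>n. b n \<le> a n" for b
    unfolding lim_iff
  proof (intro allI impI)
    fix e :: real assume "e > 0"
    then obtain m where m: "inverse (real (Suc m)) < e" using reals_Archimedean by blast
    have "\<forall>\<^sub>F n in sequentially. m \<le> b n" using b(1) unfolding filterlim_at_top by blast
    moreover have "\<forall>\<^sub>F n in sequentially. N 0 \<le> n" by (rule eventually_ge_at_top)
    ultimately show "\<forall>\<^sub>F n in sequentially. d (smul (1 / \<pi> ^ b n) (x n)) 0 < e"
    proof (rule eventually_elim2)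
      fix n assume n: "m \<le> b n" "N 0 \<le> n"
      have "N (b n) \<le> n" using mono[OF b(2)[of n]] N_a[OF n(2)] by simp
      from N[OF this] have "d (smul (1 / \<pi> ^ b n) (x n)) 0 < inverse (real (Suc (b n)))" .
      also have "\<dots> \<le> inverse (real (Suc m))" using n(1) by (simp add: le_imp_inverse_le)
      finally show "d (smul (1 / \<pi> ^ b n) (x n)) 0 < e" using m by simp
    qed
  qed
  ultimately show ?thesis by blast
qed

end

locale metrizable_tvs = ultrametric_tvs v smul
  for v :: "'k::local_field \<Rightarrow> real" and smul :: "'k \<Rightarrow> 'a \<Rightarrow> 'a::{topological_ab_group_add,t2_space}" +
  assumes metrizable: "metrizable_space (euclidean :: 'a topology)"
begin

lemma continuous_level_iff:
  "continuous_level smul U j f \<longleftrightarrow>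
    (\<forall>p x. (\<forall>n. p n \<in> iter_domain smul U j) \<longrightarrow> x \<in> iter_domain smul U j \<longrightarrow> level_lim j p x \<longrightarrow>
       (\<lambda>n. f (p n)) \<longlonglongrightarrow> f x)"
  (is "_ \<longleftrightarrow> ?R")
proof
  assume cont: "continuous_level smul U j f"
  show ?R
  proof (intro allI impI)
    fix p x assume *: "\<forall>n. p n \<in> iter_domain smul U j" "x \<in> iter_domain smul U j" "level_lim j p x"
    have "limitin (subtopology (level_topology j) (iter_domain smul U j)) p x sequentially"
      using * unfolding limitin_subtopology level_lim_def by simp
    from continuous_map_limit[OF cont[unfolded continuous_level_def] this]
    show "(\<lambda>n. f (p n)) \<longlonglongrightarrow> f x" by (simp add: o_def)
  qed
next
  assume R: ?R
  show "continuous_level smul U j f"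
    unfolding continuous_level_def
  proof (rule continuous_map_sequentially)
    show "metrizable_space (subtopology (level_topology j) (iter_domain smul U j))"
      by (intro metrizable_space_subtopology metrizable_level_topology metrizable metrizable_field)
    fix p x
    assume "\<And>n::nat. p n \<in> topspace (subtopology (level_topology j) (iter_domain smul U j))"
      and lim: "limitin (subtopology (level_topology j) (iter_domain smul U j)) p x sequentially"
    then have p: "\<And>n. p n \<in> iter_domain smul U j" by simp
    have x: "x \<in> iter_domain smul U j" "limitin (level_topology j) p x sequentially"
      using lim unfolding limitin_subtopology by auto
    then have "level_lim j p x" unfolding level_lim_def using p iter_domain_subset by blast
    then show "(\<lambda>n. f (p n)) \<longlonglongrightarrow> f x" using R p x by blast
  qed
qed

text \<open>Induction on the level: two point components and the scalar parameter each have a rate,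
  and the minimum of the three serves all of them.\<close>

lemma level_lim_rate:
  assumes "level_lim j p x"
  shows "\<exists>a. filterlim a at_top sequentially \<and>
    (\<forall>b. filterlim b at_top sequentially \<longrightarrow> (\<forall>n. b n \<le> a n) \<longrightarrow>
      (\<exists>y. (\<forall>n. p n = point_add x (point_scale smul (\<pi> ^ b n) (y n))) \<and> level_lim j y (level_zero j)))"
  using assms
proof (induction j arbitrary: p x)
  case 0
  from 0 obtain e e0 where [simp]: "p = (\<lambda>n. Base (e n))" "x = Base e0" and e: "e \<longlonglongrightarrow> e0"
    by (rule level_lim_0E)
  have "(\<lambda>n. e n - e0) \<longlonglongrightarrow> 0" using tendsto_diff[OF e tendsto_const[of e0]] by simp
  from null_sequence_rate[OF metrizable this] obtain a where a: "filterlim a at_top sequentially"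
    "\<And>b. filterlim b at_top sequentially \<Longrightarrow> (\<And>n. b n \<le> a n) \<Longrightarrow>
      (\<lambda>n. smul (1 / \<pi> ^ b n) (e n - e0)) \<longlonglongrightarrow> 0" by blast
  show ?case
  proof (intro exI[of _ a] conjI allI impI a(1))
    fix b :: "nat \<Rightarrow> nat" assume b: "filterlim b at_top sequentially" "\<forall>n. b n \<le> a n"
    show "\<exists>y. (\<forall>n. p n = point_add x (point_scale smul (\<pi> ^ b n) (y n))) \<and> level_lim 0 y (level_zero 0)"
      using a(2)[OF b(1)] b(2) by (intro exI[of _ "\<lambda>n. Base (smul (1 / \<pi> ^ b n) (e n - e0))"]) simp
  qed
next
  case (Suc j)
  interpret K: ultrametric_tvs v "(*)" by (rule field_tvs)
  from Suc(2) obtain p1 p2 c x1 x2 c0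
    where [simp]: "p = (\<lambda>n. Ext (p1 n) (p2 n) (c n))" "x = Ext x1 x2 c0"
    and lim: "level_lim j p1 x1" "level_lim j p2 x2" and c: "c \<longlonglongrightarrow> c0"
    by (rule level_lim_SucE)
  have "(\<lambda>n. c n - c0) \<longlonglongrightarrow> 0" using tendsto_diff[OF c tendsto_const[of c0]] by simp
  from K.null_sequence_rate[OF metrizable_field this] obtain a3 where a3: "filterlim a3 at_top sequentially"
    "\<And>b. filterlim b at_top sequentially \<Longrightarrow> (\<And>n. b n \<le> a3 n) \<Longrightarrow>
      (\<lambda>n. 1 / \<pi> ^ b n * (c n - c0)) \<longlonglongrightarrow> 0" by blast
  from Suc.IH[OF lim(1)] obtain a1 where a1: "filterlim a1 at_top sequentially"
    "\<And>b. filterlim b at_top sequentially \<Longrightarrow> (\<And>n. b n \<le> a1 n) \<Longrightarrow>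
      \<exists>y. (\<forall>n. p1 n = point_add x1 (point_scale smul (\<pi> ^ b n) (y n))) \<and> level_lim j y (level_zero j)"
    by blast
  from Suc.IH[OF lim(2)] obtain a2 where a2: "filterlim a2 at_top sequentially"
    "\<And>b. filterlim b at_top sequentially \<Longrightarrow> (\<And>n. b n \<le> a2 n) \<Longrightarrow>
      \<exists>y. (\<forall>n. p2 n = point_add x2 (point_scale smul (\<pi> ^ b n) (y n))) \<and> level_lim j y (level_zero j)"
    by blast
  define a where "a n = min (a1 n) (min (a2 n) (a3 n))" for n
  have "filterlim a at_top sequentially"
    using a1(1) a2(1) a3(1) unfolding filterlim_at_top a_def by (simp add: eventually_conj_iff)
  show ?case
  proof (intro exI[of _ a] conjI allI impI)
    fix b :: "nat \<Rightarrow> nat" assume b: "filterlim b at_top sequentially" and "\<forall>n. b n \<le> a n"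
    then have le: "\<And>n. b n \<le> a1 n" "\<And>n. b n \<le> a2 n" "\<And>n. b n \<le> a3 n" unfolding a_def by auto
    obtain y1 where y1: "\<forall>n. p1 n = point_add x1 (point_scale smul (\<pi> ^ b n) (y1 n))" "level_lim j y1 (level_zero j)"
      using a1(2)[OF b le(1)] by blast
    obtain y2 where y2: "\<forall>n. p2 n = point_add x2 (point_scale smul (\<pi> ^ b n) (y2 n))" "level_lim j y2 (level_zero j)"
      using a2(2)[OF b le(2)] by blast
    show "\<exists>y. (\<forall>n. p n = point_add x (point_scale smul (\<pi> ^ b n) (y n))) \<and>
        level_lim (Suc j) y (level_zero (Suc j))"
      using y1 y2 a3(2)[OF b le(3)]
      by (intro exI[of _ "\<lambda>n. Ext (y1 n) (y2 n) (1 / \<pi> ^ b n * (c n - c0))"]) simp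
  qed fact
qed

end

section \<open>Difference quotients and their uniqueness\<close>

section \<open>Weak differentiability\<close>

lemma level_lim_offset: "level_lim j p x \<Longrightarrow> level_lim j (\<lambda>n. p (n + N)) x"
  unfolding level_lim_def by (simp add: limitin_sequentially_offset)

text \<open>Large entries with both indices growing would contradict \<open>diag\<close>. What
  remains is finitely many lines: those with fixed second index converge, the others follow by
  symmetry.\<close>

lemma (in ultrametric_field) v_bounded_double_sequence:
  fixes \<phi> :: "nat \<Rightarrow> nat \<Rightarrow> 'k"
  assumes sym: "\<And>n m. \<phi> n m = \<phi> m n"
    and row: "\<And>m. \<exists>L. (\<lambda>n. \<phi> n m) \<longlonglongrightarrow> L"
    and diag: "\<And>a b. filterlim a at_top sequentially \<Longrightarrow> filterlim b at_top sequentially \<Longrightarrow>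
      (\<lambda>i. \<phi> (a i) (b i)) \<longlonglongrightarrow> L"
  shows "\<exists>C. \<forall>n m. v (\<phi> n m) \<le> C"
proof -
  have "\<exists>N. \<forall>n\<ge>N. \<forall>m\<ge>N. v (\<phi> n m) \<le> max 1 (v L)"
  proof (rule ccontr)
    assume "\<not> ?thesis"
    then obtain a b where ab: "\<And>N. N \<le> a N" "\<And>N. N \<le> b N" and big: "\<And>N. \<not> v (\<phi> (a N) (b N)) \<le> max 1 (v L)"
      by metis
    have "filterlim a at_top sequentially" "filterlim b at_top sequentially"
      by (rule filterlim_at_top_mono[OF filterlim_ident]; use ab in simp)+
    from diag[OF this] have "\<forall>\<^sub>F i in sequentially. v (\<phi> (a i) (b i) - L) < 1"
      unfolding tendsto_v_iff by simp
    then obtain i where "v (\<phi> (a i) (b i) - L) < 1" by (auto simp: eventually_sequentially)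
    then have "v (\<phi> (a i) (b i)) \<le> max 1 (v L)"
      using v_add_le[of "\<phi> (a i) (b i) - L" L] by simp
    then show False using big by blast
  qed
  then obtain N where N: "\<And>n m. n \<ge> N \<Longrightarrow> m \<ge> N \<Longrightarrow> v (\<phi> n m) \<le> max 1 (v L)" by blast
  have "\<forall>m. \<exists>C. \<forall>n. v (\<phi> n m) \<le> C"
    using row convergent_imp_v_bounded by metis
  then obtain C where C: "\<And>n m. v (\<phi> n m) \<le> C m" by metis
  define D where "D = Max (insert (max 1 (v L)) (C ` {..<N}))"
  have le_D: "c \<le> D" if "c \<in> insert (max 1 (v L)) (C ` {..<N})" for c
    unfolding D_def using that by (intro Max_ge) auto
  have "v (\<phi> n m) \<le> D" for n m
  proof -
    consider "m < N" | "n < N" | "n \<ge> N" "m \<ge> N" by linarith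
    then show ?thesis
    proof cases
      case 1
      then show ?thesis using C[of n m] le_D[of "C m"] by simp
    next
      case 2
      then show ?thesis using C[of m n] le_D[of "C n"] sym[of n m] by simp
    next
      case 3
      then show ?thesis using order_trans[OF N le_D] by simp
    qed
  qed
  then show ?thesis by blast
qed

text \<open>The codomain is kept general because the calculus is used twice: with values in
  \<open>F\<close>, and with values in the field for the compositions with functionals.\<close>

locale difference_calculus =
  ultrametric_field v + E: metrizable_tvs v scaleE + F: ultrametric_tvs v scaleF
  for v :: "'k::local_field \<Rightarrow> real"
    and scaleE :: "'k \<Rightarrow> 'e \<Rightarrow> 'e::{topological_ab_group_add,t2_space}"
    and scaleF :: "'k \<Rightarrow> 'f \<Rightarrow> 'f::{topological_ab_group_add,t2_space}" +
  fixes U :: "'e set"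
  assumes open_U: "open U"
begin

abbreviation "level_dom \<equiv> iter_domain scaleE U"
abbreviation "diff_quot \<equiv> is_difference_quotient scaleE scaleF U"

lemma continuous_levelD:
  fixes f :: "('k, 'e) point \<Rightarrow> 'f"
  assumes f: "continuous_level scaleE U j f" and lim: "level_lim j p x" and x: "x \<in> level_dom j"
  shows "(\<lambda>n. f (p n)) \<longlonglongrightarrow> f x"
proof -
  obtain N where "\<And>n. n \<ge> N \<Longrightarrow> p n \<in> level_dom j"
    using E.iter_domain_eventually[OF open_U lim x] unfolding eventually_sequentially by blast
  then have "(\<lambda>n. f (p (n + N))) \<longlonglongrightarrow> f x"
    using f[unfolded E.continuous_level_iff, rule_format, OF _ x level_lim_offset[OF lim]] by simp
  then show ?thesis by (rule LIMSEQ_offset)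
qed

text \<open>Congruence on the domain, here and in the two analogues below, is essential:
  \<open>iter_quotient\<close> is a choice with arbitrary values elsewhere, so identities between
  iterated quotients hold only there.\<close>

lemma continuous_level_cong:
  fixes f g :: "('k, 'e) point \<Rightarrow> 'f"
  assumes "\<And>p. p \<in> level_dom j \<Longrightarrow> f p = g p" "continuous_level scaleE U j f"
  shows "continuous_level scaleE U j g"
  unfolding E.continuous_level_iff
proof (intro allI impI)
  fix p x assume *: "\<forall>n. p n \<in> level_dom j" "x \<in> level_dom j" "level_lim j p x"
  from continuous_levelD[OF assms(2) this(3,2)] show "(\<lambda>n. g (p n)) \<longlonglongrightarrow> g x"
    using assms(1) * by simp
qed

lemma quotientD:
  assumes "diff_quot j f g" "Ext x y t \<in> level_dom (Suc j)" "t \<noteq> 0"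
  shows "g (Ext x y t) = scaleF (1 / t) (f (point_add x (point_scale scaleE t y)) - f x)"
  by (rule assms(1)[unfolded is_difference_quotient_def, THEN conjunct2, rule_format, OF conjI[OF assms(2,3)]])

lemma quotient_cong:
  assumes "\<And>p. p \<in> level_dom j \<Longrightarrow> f p = g p" "diff_quot j f h"
  shows "diff_quot j g h"
  unfolding is_difference_quotient_def
proof (intro conjI allI impI)
  show "continuous_level scaleE U (Suc j) h"
    using assms(2) unfolding is_difference_quotient_def by (rule conjunct1)
  fix x y t assume *: "Ext x y t \<in> level_dom (Suc j) \<and> t \<noteq> 0"
  then have "x \<in> level_dom j" "point_add x (point_scale scaleE t y) \<in> level_dom j" by auto
  then show "h (Ext x y t) = scaleF (1 / t) (g (point_add x (point_scale scaleE t y)) - g x)"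
    using quotientD[OF assms(2)] * assms(1) by metis
qed

lemma C1_level_cong:
  assumes "\<And>p. p \<in> level_dom j \<Longrightarrow> f p = g p" "C1_level scaleE scaleF U j f"
  shows "C1_level scaleE scaleF U j g"
proof -
  obtain h where "continuous_level scaleE U j f" "diff_quot j f h"
    using assms(2) unfolding C1_level_def by auto
  from continuous_level_cong[OF assms(1) this(1)] quotient_cong[OF assms(1) this(2)]
  show ?thesis unfolding C1_level_def by auto
qed

lemma level_lim_pi_power:
  assumes "Ext x y 0 \<in> level_dom (Suc j)"
  shows "level_lim (Suc j) (\<lambda>n. Ext x y (\<pi> ^ n)) (Ext x y 0)"
  using iter_domain_subset[OF assms] by (auto intro!: level_lim_const pi_power_tendsto filterlim_ident)

text \<open>At parameter 0 both quotients are limits of their values along \<open>\<pi> ^ n\<close>,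
  where they agree; limits in the codomain are unique.\<close>

lemma quotient_unique:
  assumes g: "diff_quot j f g" and h: "diff_quot j f h" and p: "p \<in> level_dom (Suc j)"
  shows "g p = h p"
proof -
  obtain x y t where [simp]: "p = Ext x y t" using p by auto
  show ?thesis
  proof (cases "t = 0")
    case False
    then show ?thesis using quotientD[OF g] quotientD[OF h] p by simp
  next
    case True
    then have dom0: "Ext x y 0 \<in> level_dom (Suc j)" using p by simp
    note lim = level_lim_pi_power[OF dom0]
    have ev: "\<forall>\<^sub>F n in sequentially. g (Ext x y (\<pi> ^ n)) = h (Ext x y (\<pi> ^ n))"
      using E.iter_domain_eventually[OF open_U lim dom0]
      by (rule eventually_mono) (simp only: quotientD[OF g] quotientD[OF h] pi_nonzero power_not_zero simp_thms)
    have g_lim: "(\<lambda>n. g (Ext x y (\<pi> ^ n))) \<longlonglongrightarrow> g (Ext x y 0)"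
      using g unfolding is_difference_quotient_def by (intro continuous_levelD[OF _ lim dom0]) simp
    have h_lim: "(\<lambda>n. h (Ext x y (\<pi> ^ n))) \<longlonglongrightarrow> h (Ext x y 0)"
      using h unfolding is_difference_quotient_def by (intro continuous_levelD[OF _ lim dom0]) simp
    have "g (Ext x y 0) = h (Ext x y 0)"
      by (rule LIMSEQ_unique[OF Lim_transform_eventually[OF g_lim ev] h_lim])
    then show ?thesis using True by simp
  qed
qed

lemma continuous_level_0_iff:
  fixes f :: "'e \<Rightarrow> 'f"
  shows "continuous_level scaleE U 0 (\<lambda>p. f (the_base p)) \<longleftrightarrow> continuous_on U f"
proof
  assume f: "continuous_on U f"
  show "continuous_level scaleE U 0 (\<lambda>p. f (the_base p))"
    unfolding E.continuous_level_iff
  proof (intro allI impI)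
    fix p x assume p: "\<forall>n. p n \<in> level_dom 0" and x: "x \<in> level_dom 0" and lim: "level_lim 0 p x"
    obtain e e0 where [simp]: "p = (\<lambda>n. Base (e n))" "x = Base e0" and e: "e \<longlonglongrightarrow> e0"
      using lim by (rule level_lim_0E)
    have "e n \<in> U" "e0 \<in> U" for n using p x by auto
    then show "(\<lambda>n. f (the_base (p n))) \<longlonglongrightarrow> f (the_base x)"
      using continuous_on_tendsto_compose[OF f e] by simp
  qed
next
  assume f: "continuous_level scaleE U 0 (\<lambda>p. f (the_base p))"
  have "continuous_map (subtopology euclidean U) euclidean f"
  proof (rule continuous_map_sequentially)
    show "metrizable_space (subtopology euclidean U)"
      by (intro metrizable_space_subtopology E.metrizable)
    fix p x assume lim: "limitin (subtopology euclidean U) p x sequentially"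
    then have "level_lim 0 (\<lambda>n. Base (p n)) (Base x)" "x \<in> U"
      unfolding limitin_subtopology by simp_all
    then show "(\<lambda>n. f (p n)) \<longlonglongrightarrow> f x" using continuous_levelD[OF f] by fastforce
  qed
  then show "continuous_on U f" by simp
qed

lemma iter_quotient_Suc:
  assumes "C1_level scaleE scaleF U j (iter_quotient scaleE scaleF U f j)"
  shows "diff_quot j (iter_quotient scaleE scaleF U f j) (iter_quotient scaleE scaleF U f (Suc j))"
proof -
  have "\<exists>g. diff_quot j (iter_quotient scaleE scaleF U f j) g"
    using assms unfolding C1_level_def by simp
  from someI_ex[OF this] show ?thesis by simp
qed

lemma Ck_continuous:
  assumes "Ck scaleE scaleF k U f"
  shows "continuous_level scaleE U k (iter_quotient scaleE scaleF U f k)"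
proof (cases k)
  case 0
  then show ?thesis using assms continuous_level_0_iff[of f] by simp
next
  case (Suc j)
  then show ?thesis using assms iter_quotient_Suc[of j f] unfolding is_difference_quotient_def by simp
qed

end

section \<open>Functionals, the one-step principle and the induction on the order\<close>

locale weak_calculus =
  ultrametric_field v + E: metrizable_tvs v scaleE + F: locally_convex_tvs v scaleF
  for v :: "'k::local_field \<Rightarrow> real"
    and scaleE :: "'k \<Rightarrow> 'e \<Rightarrow> 'e::{topological_ab_group_add,t2_space}"
    and scaleF :: "'k \<Rightarrow> 'f \<Rightarrow> 'f::{topological_ab_group_add,t2_space}" +
  fixes U :: "'e set"
  assumes open_U: "open U" and complete: "mackey_complete scaleF"
begin

sublocale F': difference_calculus v scaleE scaleF U
  by unfold_locales (rule open_U)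

sublocale K: difference_calculus v scaleE "(*)" U
  by (intro difference_calculus.intro difference_calculus_axioms.intro field_tvs
      ultrametric_field_axioms E.metrizable_tvs_axioms open_U)

abbreviation "level_dom \<equiv> iter_domain scaleE U"

lemma functionalD:
  assumes "continuous_functional scaleF l"
  shows "l (x + y) = l x + l y" "l (scaleF c x) = c * l x" "l (x - y) = l x - l y"
    "(z \<longlongrightarrow> a) G \<Longrightarrow> ((\<lambda>n. l (z n)) \<longlongrightarrow> l a) G"
proof -
  have *: "l (x + y) = l x + l y" "l (scaleF c x) = c * l x" for x y c
    using assms unfolding continuous_functional_def F.linear_functional_iff by simp_all
  then show "l (x + y) = l x + l y" "l (scaleF c x) = c * l x" by simp_all
  show "l (x - y) = l x - l y" using *(1)[of "x - y" y] by simp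
  show "(z \<longlongrightarrow> a) G \<Longrightarrow> ((\<lambda>n. l (z n)) \<longlongrightarrow> l a) G"
    using assms unfolding continuous_functional_def by (auto intro: continuous_on_tendsto_compose)
qed

lemma functional_continuous_level:
  assumes l: "continuous_functional scaleF l" and f: "continuous_level scaleE U j f"
  shows "continuous_level scaleE U j (\<lambda>p. l (f p))"
  unfolding E.continuous_level_iff
  by (intro allI impI functionalD(4)[OF l] f[unfolded E.continuous_level_iff, rule_format])
    simp_all

lemma functional_quotient:
  assumes l: "continuous_functional scaleF l" and f: "F'.diff_quot j f g"
  shows "K.diff_quot j (\<lambda>p. l (f p)) (\<lambda>p. l (g p))"
  unfolding is_difference_quotient_def
proof (intro conjI allI impI)
  show "continuous_level scaleE U (Suc j) (\<lambda>p. l (g p))"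
    using f unfolding is_difference_quotient_def by (blast intro: functional_continuous_level[OF l])
  fix x y t assume "Ext x y t \<in> level_dom (Suc j) \<and> t \<noteq> 0"
  then have "g (Ext x y t) = scaleF (1 / t) (f (point_add x (point_scale scaleE t y)) - f x)"
    using F'.quotientD[OF f] by blast
  then show "l (g (Ext x y t)) = 1 / t * (l (f (point_add x (point_scale scaleE t y))) - l (f x))"
    by (simp only: functionalD(2,3)[OF l])
qed

text \<open>Both claims go through one induction: the identity at level \<open>k\<close> makes the
  image of the next quotient a quotient of the composition, and uniqueness then gives the identity
  at the next level.\<close>

lemma functional_Ck:
  assumes l: "continuous_functional scaleF l"
  shows "Ck scaleE scaleF k U f \<Longrightarrow> Ck scaleE (*) k U (l \<circ> f) \<and>
    (\<forall>p\<in>level_dom k. iter_quotient scaleE (*) U (l \<circ> f) k p = l (iter_quotient scaleE scaleF U f k p))"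
proof (induction k)
  case 0
  have "continuous_on U (\<lambda>x. l (f x))"
    using 0 functional_continuous_level[OF l, of 0 "\<lambda>p. f (the_base p)"]
      K.continuous_level_0_iff[of "\<lambda>x. l (f x)"] F'.continuous_level_0_iff[of f] by simp
  then show ?case by (simp add: o_def)
next
  case (Suc k)
  let ?F = "iter_quotient scaleE scaleF U f" and ?K = "iter_quotient scaleE (*) U (l \<circ> f)"
  have C1: "C1_level scaleE scaleF U k (?F k)" and Ck: "Ck scaleE scaleF k U f" using Suc.prems by simp_all
  have eq: "?K k p = l (?F k p)" if "p \<in> level_dom k" for p using Suc.IH[OF Ck] that by blast
  have Q: "K.diff_quot k (?K k) (\<lambda>p. l (?F (Suc k) p))"
    by (rule K.quotient_cong[OF _ functional_quotient[OF l F'.iter_quotient_Suc[OF C1]]]) (simp add: eq)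
  have "continuous_level scaleE U k (?K k)"
    by (rule K.continuous_level_cong[OF _ functional_continuous_level[OF l F'.Ck_continuous[OF Ck]]])
      (simp add: eq)
  then have C1': "C1_level scaleE (*) U k (?K k)" using Q unfolding C1_level_def by blast
  from K.quotient_unique[OF K.iter_quotient_Suc[OF C1'] Q]
  have "?K (Suc k) p = l (?F (Suc k) p)" if "p \<in> level_dom (Suc k)" for p
    using that .
  moreover have "Ck scaleE (*) (Suc k) U (l \<circ> f)"
    using Suc.IH[OF Ck] C1' unfolding Ck.simps by blast
  ultimately show ?case by blast
qed

lemma weakly_C1_imp_continuous:
  assumes weak: "\<And>l. continuous_functional scaleF l \<Longrightarrow> C1_level scaleE (*) U j (\<lambda>p. l (g p))"
  shows "continuous_level scaleE U j g"
  unfolding E.continuous_level_iff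
proof (intro allI impI)
  fix p x assume p: "\<forall>n. p n \<in> level_dom j" and x: "x \<in> level_dom j" and lim: "level_lim j p x"
  obtain a y where a: "filterlim a at_top sequentially"
    and p_eq: "\<And>n. p n = point_add x (point_scale scaleE (\<pi> ^ a n) (y n))"
    and y: "level_lim j y (level_zero j)"
    using E.level_lim_rate[OF lim] by (metis order_refl)
  define z where "z n = scaleF (1 / \<pi> ^ a n) (g (p n) - g x)" for n
  \<comment> \<open>The base point stays fixed while directions and parameters tend to 0, so every
    scalar quotient converges along this sequence and is bounded on it.\<close>
  have q: "level_lim (Suc j) (\<lambda>n. Ext x (y n) (\<pi> ^ a n)) (Ext x (level_zero j) 0)"
    using y pi_power_tendsto[OF a] level_lim_const[OF iter_domain_subset[OF x]] by simp
  have q_dom: "Ext x (y n) (\<pi> ^ a n) \<in> level_dom (Suc j)" for n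
    using x p level_lim_space(1)[OF y] p_eq by simp
  have "bounded_set scaleF (range z)"
  proof (rule F.weakly_bounded_imp_bounded)
    fix l assume l: "continuous_functional scaleF l"
    obtain h where h: "K.diff_quot j (\<lambda>p. l (g p)) h"
      using weak[OF l] unfolding C1_level_def by blast
    have l_z: "l (z n) = h (Ext x (y n) (\<pi> ^ a n))" for n
      unfolding z_def using K.quotientD[OF h q_dom] by (simp add: functionalD(2,3)[OF l] p_eq)
    have "(\<lambda>n. h (Ext x (y n) (\<pi> ^ a n))) \<longlonglongrightarrow> h (Ext x (level_zero j) 0)"
      using h unfolding is_difference_quotient_def
      by (intro K.continuous_levelD[OF _ q] E.iter_domain_zero x) simp
    then obtain C where "\<And>n. v (l (z n)) \<le> C"
      unfolding l_z using convergent_imp_v_bounded by blast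
    then show "\<exists>C. \<forall>b\<in>range z. v (l b) \<le> C" by blast
  qed
  then have "(\<lambda>n. scaleF (\<pi> ^ a n) (z n)) \<longlonglongrightarrow> 0"
    by (rule F.bounded_scaled_tendsto_0) (auto intro: pi_power_tendsto a)
  moreover have "scaleF (\<pi> ^ a n) (z n) = g (p n) - g x" for n unfolding z_def by simp
  ultimately have "(\<lambda>n. g (p n) - g x + g x) \<longlonglongrightarrow> 0 + g x"
    by (intro tendsto_add tendsto_const) simp
  then show "(\<lambda>n. g (p n)) \<longlonglongrightarrow> g x" by simp
qed

text \<open>Under a functional, the slopes between two quotients are values of a second quotient,
  which stays continuous when the parameters collide. Hence all slopes lie in a bounded set
  \<open>B\<close>, and the quotients differ by \<open>s n - s m\<close> times an element of
  \<open>B\<close>.\<close>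

lemma weakly_C2_imp_quotient_convergent:
  assumes weak: "\<And>l. continuous_functional scaleF l \<Longrightarrow>
      \<exists>h. K.diff_quot j (\<lambda>p. l (g p)) h \<and> C1_level scaleE (*) U (Suc j) h"
    and dom0: "Ext x y 0 \<in> level_dom (Suc j)"
  shows "convergent (\<lambda>n. scaleF (1 / \<pi> ^ n) (g (point_add x (point_scale scaleE (\<pi> ^ n) y)) - g x))"
    (is "convergent ?z")
proof -
  have x: "x \<in> level_space j" and y: "y \<in> level_space j"
    using dom0 iter_domain_subset by auto
  obtain N where N: "\<And>n. n \<ge> N \<Longrightarrow> Ext x y (\<pi> ^ n) \<in> level_dom (Suc j)"
    using E.iter_domain_eventually[OF open_U K.level_lim_pi_power[OF dom0] dom0]
    unfolding eventually_sequentially by blast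
  \<comment> \<open>The points are in the domain only eventually; the shift by \<open>N\<close>
    makes this hold for all indices.\<close>
  define s where "s n = \<pi> ^ (n + N)" for n
  define w where "w n = ?z (n + N)" for n
  have s_dom: "Ext x y (s n) \<in> level_dom (Suc j)" for n unfolding s_def by (rule N) simp
  have s_nz: "s n \<noteq> 0" for n unfolding s_def by simp
  have s_lim: "(\<lambda>i. s (a i)) \<longlonglongrightarrow> 0" if "filterlim a at_top sequentially" for a
    using LIMSEQ_ignore_initial_segment[OF pi_power_tendsto[OF filterlim_ident], of N]
    unfolding s_def by (rule filterlim_compose[OF _ that])
  have s_inj: "s n \<noteq> s m" if "n \<noteq> m" for n m
  proof
    assume "s n = s m"
    then have "v \<pi> ^ (n + N) = v \<pi> ^ (m + N)" unfolding s_def by (metis v_power)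
    then show False using that v_pi power_inject_exp'[of "v \<pi>" "n + N" "m + N"] by simp
  qed
  define B where "B = {scaleF (1 / (s n - s m)) (w n - w m) | n m. True}"
  have "bounded_set scaleF B"
  proof (rule F.weakly_bounded_imp_bounded)
    fix l assume l: "continuous_functional scaleF l"
    obtain h k where h: "K.diff_quot j (\<lambda>p. l (g p)) h" and k: "K.diff_quot (Suc j) h k"
      using weak[OF l] unfolding C1_level_def by blast
    have l_w: "l (w n) = h (Ext x y (s n))" for n
      unfolding w_def using K.quotientD[OF h s_dom s_nz, of n]
      by (simp add: functionalD(2,3)[OF l] s_def)
    \<comment> \<open>The direction \<open>(0, 0, 1)\<close> moves only the parameter, so
      \<open>k (P a b)\<close> is the slope of \<open>h\<close> between the parameters
      \<open>b\<close> and \<open>a\<close>; for \<open>a = b\<close> it is the value of the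
      continuous extension.\<close>
    define P where "P a b = Ext (Ext x y b) (Ext (level_zero j) (level_zero j) 1) (a - b)" for a b :: 'k
    have shift: "point_add (Ext x y b) (point_scale scaleE (a - b) (Ext (level_zero j) (level_zero j) 1))
        = Ext x y a" for a b using x y by simp
    have P_dom: "P a b \<in> level_dom (Suc (Suc j))"
      if "Ext x y a \<in> level_dom (Suc j)" "Ext x y b \<in> level_dom (Suc j)" for a b
    proof -
      have "Ext (level_zero j) (level_zero j) 1 \<in> level_space (Suc j)" by simp
      then show ?thesis
        unfolding P_def iter_domain.simps(2)[of _ _ "Suc j"] mem_Collect_eq point.inject
        using that shift[of b a] by metis
    qed
    define \<phi> where "\<phi> n m = k (P (s n) (s m))" for n m
    have phi: "\<phi> n m = (l (w n) - l (w m)) / (s n - s m)" if "n \<noteq> m" for n m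
    proof -
      have "s n - s m \<noteq> 0" using s_inj[OF that] by simp
      from K.quotientD[OF k P_dom[OF s_dom s_dom, of n m, unfolded P_def] this]
      have "k (P (s n) (s m)) = 1 / (s n - s m) * (h (Ext x y (s n)) - h (Ext x y (s m)))"
        unfolding shift P_def .
      then show ?thesis unfolding \<phi>_def l_w by simp
    qed
    have k_lim: "(\<lambda>i. k (P (a i) (b i))) \<longlonglongrightarrow> k (P a0 b0)"
      if "a \<longlonglongrightarrow> a0" "b \<longlonglongrightarrow> b0" "Ext x y a0 \<in> level_dom (Suc j)" "Ext x y b0 \<in> level_dom (Suc j)" for a b a0 b0
    proof (rule K.continuous_levelD)
      show "continuous_level scaleE U (Suc (Suc j)) k"
        using k unfolding is_difference_quotient_def by simp
      show "level_lim (Suc (Suc j)) (\<lambda>i. P (a i) (b i)) (P a0 b0)"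
        unfolding P_def using that x y by (auto intro!: level_lim_const tendsto_diff)
      show "P a0 b0 \<in> level_dom (Suc (Suc j))" by (rule P_dom[OF that(3,4)])
    qed
    have "\<exists>C. \<forall>n m. v (\<phi> n m) \<le> C"
    proof (rule v_bounded_double_sequence)
      show "\<phi> n m = \<phi> m n" for n m
      proof (cases "n = m")
        case False
        then have "\<phi> n m = - (l (w m) - l (w n)) / - (s m - s n)" by (simp add: phi)
        also have "\<dots> = \<phi> m n" using False phi[of m n] unfolding minus_divide_divide by simp
        finally show ?thesis .
      qed simp
      show "\<exists>L. (\<lambda>n. \<phi> n m) \<longlonglongrightarrow> L" for m
        unfolding \<phi>_def using k_lim[OF s_lim[OF filterlim_ident] tendsto_const dom0 s_dom] by blast
      show "(\<lambda>i. \<phi> (a i) (b i)) \<longlonglongrightarrow> k (P 0 0)"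
        if "filterlim a at_top sequentially" "filterlim b at_top sequentially" for a b
        unfolding \<phi>_def by (rule k_lim[OF s_lim[OF that(1)] s_lim[OF that(2)] dom0 dom0])
    qed
    then obtain C where C: "\<And>n m. v (\<phi> n m) \<le> C" by blast
    have "v (l (scaleF (1 / (s n - s m)) (w n - w m))) \<le> max C 0" for n m
    proof (cases "n = m")
      case True
      then show ?thesis using functionalD(3)[OF l, of 0 0] by simp
    next
      case False
      then show ?thesis using C[of n m] by (simp add: functionalD(2,3)[OF l] phi max.coboundedI1)
    qed
    then show "\<exists>C. \<forall>b\<in>B. v (l b) \<le> C" unfolding B_def by blast
  qed
  moreover have "w n - w m \<in> scaleF (s n - s m) ` B" for n m
  proof (rule image_eqI)
    show "w n - w m = scaleF (s n - s m) (scaleF (1 / (s n - s m)) (w n - w m))"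
      using s_inj[of n m] by (cases "n = m") simp_all
  qed (auto simp: B_def)
  moreover have "((\<lambda>(n, m). s n - s m) \<longlongrightarrow> 0) (sequentially \<times>\<^sub>F sequentially)"
  proof -
    have "((\<lambda>p. s (fst p) - s (snd p)) \<longlongrightarrow> 0 - 0) (sequentially \<times>\<^sub>F sequentially)"
      by (intro tendsto_diff filterlim_compose[OF s_lim[OF filterlim_ident]] filterlim_fst filterlim_snd)
    then show ?thesis by (simp add: case_prod_beta')
  qed
  ultimately have "mackey_Cauchy scaleF w"
    unfolding mackey_Cauchy_def by (intro exI[of _ B] exI[of _ "\<lambda>n m. s n - s m"]) simp
  then obtain L where "w \<longlonglongrightarrow> L" using complete unfolding mackey_complete_def convergent_def by blast
  then have "?z \<longlonglongrightarrow> L" unfolding w_def by (rule LIMSEQ_offset)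
  then show ?thesis by (rule convergentI)
qed

text \<open>Weak C^2 is spelled out relative to level \<open>j\<close>: \<open>Ck\<close> speaks
  only of maps on \<open>U\<close>, while the principle is applied to iterated quotients.\<close>

lemma weakly_C2_imp_C1:
  assumes weak: "\<And>l. continuous_functional scaleF l \<Longrightarrow>
      C1_level scaleE (*) U j (\<lambda>p. l (g p)) \<and>
      (\<exists>h. K.diff_quot j (\<lambda>p. l (g p)) h \<and> C1_level scaleE (*) U (Suc j) h)"
  shows "C1_level scaleE scaleF U j g"
proof -
  define Q where "Q x y t = scaleF (1 / t) (g (point_add x (point_scale scaleE t y)) - g x)" for x y t
  \<comment> \<open>On the domain the limit exists by the preceding lemma; elsewhere its value is
    irrelevant.\<close>
  define G where "G p = (if ext_par p = 0 then lim (\<lambda>n. Q (ext_pt p) (ext_dir p) (\<pi> ^ n))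
      else Q (ext_pt p) (ext_dir p) (ext_par p))" for p
  have Q_lim: "(\<lambda>n. Q x y (\<pi> ^ n)) \<longlonglongrightarrow> G (Ext x y 0)" if "Ext x y 0 \<in> level_dom (Suc j)" for x y
    using weakly_C2_imp_quotient_convergent[OF _ that] weak
    unfolding G_def Q_def by (simp add: convergent_LIMSEQ_iff)
  \<comment> \<open>Every functional carries \<open>G\<close> to the quotient \<open>h\<close> of
    its composition; at parameter 0 both sides are limits along \<open>\<pi> ^ n\<close>. So
    \<open>G\<close> inherits weak C^1 from \<open>h\<close>.\<close>
  have G_eq: "l (G p) = h p"
    if l: "continuous_functional scaleF l" and h: "K.diff_quot j (\<lambda>p. l (g p)) h" and p: "p \<in> level_dom (Suc j)"
    for l h p
  proof -
    have l_Q: "l (Q x y t) = h (Ext x y t)" if "Ext x y t \<in> level_dom (Suc j)" "t \<noteq> 0" for x y t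
      unfolding Q_def using K.quotientD[OF h that] by (simp add: functionalD(2,3)[OF l])
    obtain x y t where p_eq: "p = Ext x y t" using p by auto
    show ?thesis
    proof (cases "t = 0")
      case False
      then show ?thesis using l_Q p unfolding p_eq G_def by simp
    next
      case True
      then have dom0: "Ext x y 0 \<in> level_dom (Suc j)" using p p_eq by simp
      note lim = K.level_lim_pi_power[OF dom0]
      have ev: "\<forall>\<^sub>F n in sequentially. l (Q x y (\<pi> ^ n)) = h (Ext x y (\<pi> ^ n))"
        using E.iter_domain_eventually[OF open_U lim dom0] by (rule eventually_mono) (rule l_Q, auto)
      have h_lim: "(\<lambda>n. h (Ext x y (\<pi> ^ n))) \<longlonglongrightarrow> h (Ext x y 0)"
        using h unfolding is_difference_quotient_def by (intro K.continuous_levelD[OF _ lim dom0]) simp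
      have "l (G (Ext x y 0)) = h (Ext x y 0)"
        by (rule LIMSEQ_unique[OF Lim_transform_eventually[OF functionalD(4)[OF l Q_lim[OF dom0]] ev] h_lim])
      then show ?thesis using True p_eq by simp
    qed
  qed
  have "continuous_level scaleE U (Suc j) G"
  proof (rule weakly_C1_imp_continuous)
    fix l assume l: "continuous_functional scaleF l"
    obtain h where h: "K.diff_quot j (\<lambda>p. l (g p)) h" "C1_level scaleE (*) U (Suc j) h"
      using weak[OF l] by blast
    show "C1_level scaleE (*) U (Suc j) (\<lambda>p. l (G p))"
      by (rule K.C1_level_cong[OF _ h(2)]) (simp add: G_eq[OF l h(1)])
  qed
  then have "F'.diff_quot j g G"
    unfolding is_difference_quotient_def G_def Q_def by simp
  moreover have "continuous_level scaleE U j g"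
    using weak by (intro weakly_C1_imp_continuous) blast
  ultimately show ?thesis unfolding C1_level_def by blast
qed

lemma Ck_imp_weakly_Ck: "Ck scaleE scaleF k U f \<Longrightarrow> weakly_Ck scaleE scaleF k U f"
  unfolding weakly_Ck_def using functional_Ck[THEN conjunct1] by (intro allI impI)

text \<open>With \<open>k + 2\<close> weak orders the \<open>k\<close>-th and the next iterated
  quotient of \<open>l \<circ> f\<close> are both C^1. By \<open>functional_Ck\<close> the former is
  \<open>l\<close> composed with the \<open>k\<close>-th quotient of \<open>f\<close>, which is the
  input of the one-step principle.\<close>

lemma weakly_Ck_imp_Ck: "weakly_Ck scaleE scaleF (Suc k) U f \<Longrightarrow> Ck scaleE scaleF k U f"
proof (induction k)
  case 0
  have "continuous_level scaleE U 0 (\<lambda>p. f (the_base p))"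
  proof (rule weakly_C1_imp_continuous)
    fix l assume "continuous_functional scaleF l"
    then have "Ck scaleE (*) (Suc 0) U (l \<circ> f)"
      using 0[unfolded weakly_Ck_def, rule_format] by blast
    then show "C1_level scaleE (*) U 0 (\<lambda>p. l (f (the_base p)))"
      unfolding Ck.simps iter_quotient.simps o_def by (rule conjunct2)
  qed
  then show ?case using F'.continuous_level_0_iff[of f] by simp
next
  case (Suc k)
  have Ck: "Ck scaleE scaleF k U f"
    by (rule Suc.IH) (use Suc.prems in \<open>unfold weakly_Ck_def Ck.simps, blast\<close>)
  have "C1_level scaleE scaleF U k (iter_quotient scaleE scaleF U f k)"
  proof (rule weakly_C2_imp_C1)
    fix l assume l: "continuous_functional scaleF l"
    let ?F = "iter_quotient scaleE scaleF U f" and ?K = "iter_quotient scaleE (*) U (l \<circ> f)"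
    have "Ck scaleE (*) (Suc (Suc k)) U (l \<circ> f)" using Suc.prems l unfolding weakly_Ck_def by blast
    then have C: "C1_level scaleE (*) U k (?K k)" "C1_level scaleE (*) U (Suc k) (?K (Suc k))"
      unfolding Ck.simps by blast+
    have eq: "?K k p = l (?F k p)" if "p \<in> level_dom k" for p using functional_Ck[OF l Ck] that by blast
    have "C1_level scaleE (*) U k (\<lambda>p. l (?F k p))" by (rule K.C1_level_cong[OF eq C(1)])
    moreover have "K.diff_quot k (\<lambda>p. l (?F k p)) (?K (Suc k))"
      by (rule K.quotient_cong[OF eq K.iter_quotient_Suc[OF C(1)]])
    ultimately show "C1_level scaleE (*) U k (\<lambda>p. l (?F k p)) \<and>
        (\<exists>h. K.diff_quot k (\<lambda>p. l (?F k p)) h \<and> C1_level scaleE (*) U (Suc k) h)"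
      using C(2) by blast
  qed
  then show ?case using Ck by simp
qed

end

theorem theoremD1:
  fixes v :: "'k::local_field \<Rightarrow> real"
    and scaleE :: "'k \<Rightarrow> 'e \<Rightarrow> 'e::{topological_ab_group_add,t2_space}"
    and scaleF :: "'k \<Rightarrow> 'f \<Rightarrow> 'f::{topological_ab_group_add,t2_space}"
    and U :: "'e set" and f :: "'e \<Rightarrow> 'f" and k :: nat
  assumes "ultrametric_absolute_value v"
    and "topological_vector_space scaleE" and "topological_vector_space scaleF"
    and "open U"
    and "metrizable_space (euclidean :: 'e topology)"
    and "mackey_complete scaleF" and "locally_convex v scaleF"
  shows "(Ck scaleE scaleF k U f \<longrightarrow> weakly_Ck scaleE scaleF k U f) \<and>
         (weakly_Ck scaleE scaleF (Suc k) U f \<longrightarrow> Ck scaleE scaleF k U f) \<and>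
         (smooth_map scaleE scaleF U f \<longleftrightarrow> weakly_smooth scaleE scaleF U f)"
proof -
  interpret weak_calculus v scaleE scaleF U
    using assms by unfold_locales
  have smooth: "weakly_smooth scaleE scaleF U f \<longleftrightarrow> (\<forall>k. weakly_Ck scaleE scaleF k U f)"
    unfolding weakly_smooth_def weakly_Ck_def smooth_map_def by blast
  have b: "Ck scaleE scaleF k U f" if "weakly_Ck scaleE scaleF (Suc k) U f" for k
    using that by (rule weakly_Ck_imp_Ck)
  have "smooth_map scaleE scaleF U f \<longleftrightarrow> weakly_smooth scaleE scaleF U f"
    unfolding smooth smooth_map_def
  proof (intro iffI allI)
    show "weakly_Ck scaleE scaleF k U f" if "\<forall>k. Ck scaleE scaleF k U f" for k
      using that by (intro Ck_imp_weakly_Ck) simp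
    \<comment> \<open>The order lost in (b) is recovered by taking the weak hypothesis at
      \<open>Suc k\<close>.\<close>
    show "Ck scaleE scaleF k U f" if "\<forall>k. weakly_Ck scaleE scaleF k U f" for k
      using b that by blast
  qed
  then show ?thesis using Ck_imp_weakly_Ck b by simp
qed

end
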